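(* Let $P=Q'\oplus a\oplus b\oplus Q''+P_2$ be a poset on $[n]$ and let $P'=P\setminus\{(a,b)\}$. Write $M^P=\sum_{i}x_iG_i$ and suppose that the matrices $G_i$ are simultaneously upper-triangularizable. If $M^P$ has the upset property, then so does $M^{P'}$. In particular, for each eigenvalue $x^{\mathfrak s}=\sum_k c_k^{\mathfrak s}x_k$ of $M^P$ (counted with multiplicity), $M^{P'}$ has two eigenvalues, given by $$\begin{cases} x^{\mathfrak s},\quad \displaystyle\sum_{k\not\preceq_P b}c_k^{\mathfrak s}x_k-\sum_{k\prec_P a}c_k^{\mathfrak s}x_k & \text{if } x_a,x_b\in x^{\mathfrak s}\text{ or }x_a,x_b\notin x^{\mathfrak s},\\[2mm] x^{\mathfrak s},\quad x^{\mathfrak s}-c_b^{\mathfrak s}x_b+c_b^{\mathfrak s}x_a & \text{if } x_a\notin x^{\mathfrak s},\ x_b\in x^{\mathfrak s}.\end{cases}$$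
   Context: All posets are finite. The direct sum $P+Q$ is the disjoint union of $P$ and $Q$ with no relations between them; the ordinal sum $P\oplus Q$ is the disjoint union with the relations of $P$, of $Q$, and $x\prec y$ for all $x\in P$, $y\in Q$; $\oplus$ is performed before $+$. In $Q'\oplus a\oplus b\oplus Q''+P_2$, $a$ and $b$ denote single elements and $Q',Q'',P_2$ are arbitrary (possibly empty) posets. For such $P$, $P\setminus\{(a,b)\}$ denotes the poset $Q'\oplus(\{a\}+\{b\})\oplus Q''+P_2$, obtained by dropping only the relation $a\prec b$. A linear extension of a poset $P$ with $n$ elements is a word $\pi=\pi_1\cdots\pi_n$ listing each element once, such that $\pi_i\prec\pi_j$ implies $i<j$; $\mathcal L(P)$ is the set of linear extensions. For $1\le i\le n-1$, $\tau_i\pi$ is obtained from $\pi$ by interchanging $\pi_i$ and $\pi_{i+1}$ if these are incomparable in $P$, and $\tau_i\pi=\pi$ otherwise. For $1\le i\le n$, $\partial_i=\tau_{n-1}\cdots\tau_{i+1}\tau_i$ ($\tau_i$ applied first; $\partial_n$ is the identity). The promotion transition matrix $M^P$ has rows and columns indexed by $\mathcal L(P)$, with $(\pi,\pi')$ entry $\sum x_{\pi_i}$, the sum over all $i$ with $\partial_i\pi=\pi'$; $x_1,\dots,x_n$ are indeterminates. Thus $M^P=\sum_ix_iG_i$ where $G_i$ is the $0/1$ matrix with $(\pi,\pi')$ entry $1$ iff $\pi'=\partial_{\pi^{-1}(i)}\pi$, $\pi^{-1}(i)$ being the position of the letter $i$ in $\pi$. Simultaneously upper-triangularizable means there is an invertible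 complex matrix $S$ such that $SG_iS^{-1}$ is upper triangular for all $i$. For a linear form $x^{\mathfrak s}=\sum_kc_k^{\mathfrak s}x_k$, write $x_k\in x^{\mathfrak s}$ if $c_k^{\mathfrak s}\neq0$ and $x_k\notin x^{\mathfrak s}$ otherwise. For a poset $P$ let $R_P$ be the set of all pairs $(a,b)$ for which $P$ can be written in the form $P=Q'\oplus a\oplus b\oplus Q''+P_2$. The matrix $M^P$ has the upset property if its characteristic polynomial factors into linear terms (i.e. all eigenvalues are linear forms in $x_1,\dots,x_n$ with constant coefficients) and for each eigenvalue $x^{\mathfrak s}=\sum_kc_k^{\mathfrak s}x_k$ of $M^P$ and each pair $(a,b)\in R_P$: (a) if $x_a\in x^{\mathfrak s}$ then $x_b\in x^{\mathfrak s}$ and $c_a^{\mathfrak s}=c_b^{\mathfrak s}$; (b) if $x_b\in x^{\mathfrak s}$ and $x_a\notin x^{\mathfrak s}$, then $x_k\notin x^{\mathfrak s}$ for all $k\prec_Pa$. *)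

theory Defs
  imports
    "HOL-Library.Poly_Mapping"
    "Jordan_Normal_Form.Char_Poly"
begin

section \<open>Posets and their sums\<close>

text \<open>A finite poset is given by its reflexive order relation; its ground set is the \<^const>\<open>Field\<close>.\<close>

definition point :: "'a \<Rightarrow> 'a rel" where
  "point a = {(a, a)}"

definition direct_sum :: "'a rel \<Rightarrow> 'a rel \<Rightarrow> 'a rel"  (infixr "[+]" 65) where
  "P [+] Q = P \<union> Q"

definition ordinal_sum :: "'a rel \<Rightarrow> 'a rel \<Rightarrow> 'a rel"  (infixr "[\<oplus>]" 70) where
  "P [\<oplus>] Q = P \<union> Q \<union> Field P \<times> Field Q"

text \<open>Both sums are meant for posets on disjoint ground sets, which is required here explicitly.
  The posets \<open>Q'\<close>, \<open>Q''\<close>, \<open>P2\<close> may be empty.\<close>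

definition has_form :: "'a rel \<Rightarrow> 'a rel \<Rightarrow> 'a \<Rightarrow> 'a \<Rightarrow> 'a rel \<Rightarrow> 'a rel \<Rightarrow> bool" where
  "has_form P Q' a b Q'' P2 \<longleftrightarrow>
     Partial_order Q' \<and> Partial_order Q'' \<and> Partial_order P2 \<and>
     a \<noteq> b \<and>
     a \<notin> Field Q' \<union> Field Q'' \<union> Field P2 \<and>
     b \<notin> Field Q' \<union> Field Q'' \<union> Field P2 \<and>
     Field Q' \<inter> Field Q'' = {} \<and>
     Field Q' \<inter> Field P2 = {} \<and>
     Field Q'' \<inter> Field P2 = {} \<and>
     P = Q' [\<oplus>] point a [\<oplus>] point b [\<oplus>] Q'' [+] P2"

definition R_pairs :: "'a rel \<Rightarrow> ('a \<times> 'a) set" where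
  "R_pairs P = {(a, b). \<exists>Q' Q'' P2. has_form P Q' a b Q'' P2}"

lemma Field_ordinal_sum: "Field (P [\<oplus>] Q) = Field P \<union> Field Q"
  by (auto simp: ordinal_sum_def Field_def)

lemma Field_direct_sum: "Field (P [+] Q) = Field P \<union> Field Q"
  by (auto simp: direct_sum_def Field_def)

lemma Field_point: "Field (point a) = {a}"
  by (auto simp: point_def Field_def)

lemma has_form_remove:
  assumes "has_form P Q' a b Q'' P2"
  shows "P - {(a, b)} = Q' [\<oplus>] (point a [+] point b) [\<oplus>] Q'' [+] P2"
proof -
  have P: "P = Q' [\<oplus>] point a [\<oplus>] point b [\<oplus>] Q'' [+] P2"
    and ab: "a \<noteq> b" "a \<notin> Field Q'" "b \<notin> Field Q'" "a \<notin> Field Q''" "b \<notin> Field Q''"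
    using assms unfolding has_form_def by blast+
  have notin: "(a, b) \<notin> Q'" "(a, b) \<notin> Q''" "(a, b) \<notin> P2"
    using assms by (auto simp: has_form_def Field_def)
  have "P = Q' \<union> {(a, a), (b, b)} \<union> Q'' \<union> P2 \<union> {(a, b)} \<union> {a, b} \<times> Field Q''
      \<union> Field Q' \<times> ({a, b} \<union> Field Q'')"
    unfolding P direct_sum_def ordinal_sum_def[of Q'] Field_ordinal_sum Field_point
    unfolding ordinal_sum_def[of "point a"] Field_ordinal_sum Field_point
    unfolding ordinal_sum_def Field_point unfolding point_def by blast
  moreover have "Q' [\<oplus>] (point a [+] point b) [\<oplus>] Q'' [+] P2 =
      Q' \<union> {(a, a), (b, b)} \<union> Q'' \<union> P2 \<union> {a, b} \<times> Field Q''
      \<union> Field Q' \<times> ({a, b} \<union> Field Q'')"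
    unfolding ordinal_sum_def[of Q'] Field_ordinal_sum Field_direct_sum Field_point
    unfolding ordinal_sum_def Field_direct_sum Field_point
    unfolding direct_sum_def point_def by blast
  ultimately show ?thesis
    using ab notin by auto
qed


section \<open>Linear extensions and promotion\<close>

text \<open>Positions in a word are counted from 1, so the \<open>i\<close>-th letter of \<open>w\<close> is \<open>w ! (i - 1)\<close>.\<close>

definition lin_exts :: "nat \<Rightarrow> nat rel \<Rightarrow> nat list set" where
  "lin_exts n P = {w. distinct w \<and> set w = {1..n} \<and>
     (\<forall>i\<in>{1..n}. \<forall>j\<in>{1..n}.
        (w ! (i - 1), w ! (j - 1)) \<in> P \<and> w ! (i - 1) \<noteq> w ! (j - 1) \<longrightarrow> i < j)}"

definition \<tau> :: "nat rel \<Rightarrow> nat \<Rightarrow> nat list \<Rightarrow> nat list" where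
  "\<tau> P i w =
     (if (w ! (i - 1), w ! i) \<notin> P \<and> (w ! i, w ! (i - 1)) \<notin> P
      then w[i - 1 := w ! i, i := w ! (i - 1)] else w)"

definition promotion :: "nat \<Rightarrow> nat rel \<Rightarrow> nat \<Rightarrow> nat list \<Rightarrow> nat list" where
  "promotion n P i = fold (\<tau> P) [i..<n]"

definition lin_ext_list :: "nat \<Rightarrow> nat rel \<Rightarrow> nat list list" where
  "lin_ext_list n P = filter (\<lambda>w. w \<in> lin_exts n P) (List.n_lists n [1..<Suc n])"

lemma set_lin_ext_list: "set (lin_ext_list n P) = lin_exts n P"
proof -
  have "length w = n" if "w \<in> lin_exts n P" for w
    using that distinct_card[of w] by (simp add: lin_exts_def)
  then show ?thesis
    by (auto simp: lin_ext_list_def set_n_lists lin_exts_def)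
qed

lemma distinct_lin_ext_list: "distinct (lin_ext_list n P)"
  unfolding lin_ext_list_def by (intro distinct_filter distinct_n_lists) simp


section \<open>The promotion transition matrix\<close>

text \<open>Polynomials with complex coefficients in indeterminates indexed by the natural numbers.\<close>

type_synonym cpoly = "(nat \<Rightarrow>\<^sub>0 nat) \<Rightarrow>\<^sub>0 complex"

definition var :: "nat \<Rightarrow> cpoly" where
  "var k = Poly_Mapping.single (Poly_Mapping.single k 1) 1"

definition const :: "complex \<Rightarrow> cpoly" where
  "const c = Poly_Mapping.single 0 c"

definition coef :: "cpoly \<Rightarrow> nat \<Rightarrow> complex" where
  "coef f k = Poly_Mapping.lookup f (Poly_Mapping.single k 1)"

definition linear_form :: "nat \<Rightarrow> cpoly \<Rightarrow> bool" where
  "linear_form n f \<longleftrightarrow> (\<exists>c. f = (\<Sum>k=1..n. const (c k) * var k))"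

lemma coef_linear_form:
  assumes "k \<in> {1..n}"
  shows "coef (\<Sum>j=1..n. const (c j) * var j) k = c k"
proof -
  have single: "Poly_Mapping.single j (1::nat) = Poly_Mapping.single k 1 \<longleftrightarrow> j = k" for j
    by (metis lookup_single_eq lookup_single_not_eq zero_neq_one)
  have "coef (\<Sum>j=1..n. const (c j) * var j) k = (\<Sum>j=1..n. if j = k then c j else 0)"
    unfolding coef_def lookup_sum const_def var_def mult_single lookup_single
    by (intro sum.cong refl) (simp add: when_def single[unfolded One_nat_def])
  then show ?thesis
    using assms by simp
qed

definition promotion_mat :: "nat \<Rightarrow> nat rel \<Rightarrow> cpoly mat" where
  "promotion_mat n P = (let L = lin_ext_list n P in
     mat (length L) (length L)
       (\<lambda>(r, c). \<Sum>i | i \<in> {1..n} \<and> promotion n P i (L ! r) = L ! c. var (L ! r ! (i - 1))))"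

definition position :: "nat \<Rightarrow> nat list \<Rightarrow> nat \<Rightarrow> nat" where
  "position n w i = (THE j. j \<in> {1..n} \<and> w ! (j - 1) = i)"

definition G_mat :: "nat \<Rightarrow> nat rel \<Rightarrow> nat \<Rightarrow> complex mat" where
  "G_mat n P i = (let L = lin_ext_list n P in
     mat (length L) (length L)
       (\<lambda>(r, c). if L ! c = promotion n P (position n (L ! r) i) (L ! r) then 1 else 0))"

lemma promotion_mat_eq_sum:
  assumes "r < length (lin_ext_list n P)" "c < length (lin_ext_list n P)"
  shows "promotion_mat n P $$ (r, c) = (\<Sum>i=1..n. var i * const (G_mat n P i $$ (r, c)))"
proof -
  define w where "w = lin_ext_list n P ! r"
  define w' where "w' = lin_ext_list n P ! c"
  have "w \<in> lin_exts n P"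
    using assms set_lin_ext_list nth_mem unfolding w_def by blast
  then have dist: "distinct w" and set: "set w = {1..n}"
    by (auto simp: lin_exts_def)
  have len: "length w = n"
    using distinct_card[OF dist] set by simp
  have inj: "j = j'" if "j \<in> {1..n}" "j' \<in> {1..n}" "w ! (j - 1) = w ! (j' - 1)" for j j'
  proof -
    have "j - 1 < length w" "j' - 1 < length w"
      using that len by auto
    then have "j - 1 = j' - 1"
      using that nth_eq_iff_index_eq[OF dist] by blast
    then show ?thesis
      using that by (simp add: eq_diff_iff)
  qed
  have pos: "position n w (w ! (j - 1)) = j" if "j \<in> {1..n}" for j
    unfolding position_def using that inj by (intro the_equality) auto
  have "bij_betw (\<lambda>j. w ! (j - 1)) {1..n} {1..n}"
  proof (rule bij_betw_imageI)
    show "inj_on (\<lambda>j. w ! (j - 1)) {1..n}"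
      using inj by (auto intro: inj_onI)
    have "(\<lambda>j. w ! (j - 1)) ` {1..n} \<subseteq> {1..n}"
      using nth_mem[of _ w] len set by auto
    then show "(\<lambda>j. w ! (j - 1)) ` {1..n} = {1..n}"
      using \<open>inj_on _ _\<close> by (intro endo_inj_surj) auto
  qed
  then have "(\<Sum>i=1..n. var i * const (G_mat n P i $$ (r, c))) =
      (\<Sum>j=1..n. var (w ! (j - 1)) * const (G_mat n P (w ! (j - 1)) $$ (r, c)))"
    by (rule sum.reindex_bij_betw[symmetric])
  also have "\<dots> = (\<Sum>j=1..n. if promotion n P j w = w' then var (w ! (j - 1)) else 0)"
    using assms pos
    by (intro sum.cong refl)
      (auto simp: G_mat_def Let_def const_def w_def[symmetric] w'_def[symmetric] simp flip: single_one)
  also have "\<dots> = promotion_mat n P $$ (r, c)"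
    using assms by (subst sum.inter_filter[symmetric]) (simp_all add: promotion_mat_def Let_def w_def w'_def)
  finally show ?thesis ..
qed

definition simultaneously_triangularizable :: "nat \<Rightarrow> nat rel \<Rightarrow> bool" where
  "simultaneously_triangularizable n P \<longleftrightarrow>
     (let N = card (lin_exts n P) in
      \<exists>S \<in> carrier_mat N N. \<exists>S_inv \<in> carrier_mat N N.
        S * S_inv = 1\<^sub>m N \<and> S_inv * S = 1\<^sub>m N \<and>
        (\<forall>i\<in>{1..n}. upper_triangular (S * G_mat n P i * S_inv)))"


section \<open>Eigenvalues and the upset property\<close>

text \<open>Eigenvalues are the roots of the characteristic polynomial in the polynomial ring
  \<^typ>\<open>cpoly\<close>, counted with multiplicity.\<close>

definition eigenvalues :: "cpoly mat \<Rightarrow> cpoly multiset" where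
  "eigenvalues A = proots (char_poly A)"

definition upset_property :: "nat \<Rightarrow> nat rel \<Rightarrow> bool" where
  "upset_property n P \<longleftrightarrow>
     char_poly (promotion_mat n P) = (\<Prod>f\<in>#eigenvalues (promotion_mat n P). [:- f, 1:]) \<and>
     (\<forall>f\<in>#eigenvalues (promotion_mat n P). linear_form n f) \<and>
     (\<forall>f\<in>#eigenvalues (promotion_mat n P). \<forall>(a, b)\<in>R_pairs P.
        (coef f a \<noteq> 0 \<longrightarrow> coef f b \<noteq> 0 \<and> coef f a = coef f b) \<and>
        (coef f b \<noteq> 0 \<and> coef f a = 0 \<longrightarrow> (\<forall>k. (k, a) \<in> P \<and> k \<noteq> a \<longrightarrow> coef f k = 0)))"

text \<open>The eigenvalue accompanying \<open>f\<close> when the relation \<open>a \<prec> b\<close> is dropped.  The last branch is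
  meant for \<open>x\<^sub>a \<notin> f\<close>, \<open>x\<^sub>b \<in> f\<close>; the remaining case \<open>x\<^sub>a \<in> f\<close>, \<open>x\<^sub>b \<notin> f\<close> cannot
  occur under the upset property.\<close>

definition second_eigenvalue :: "nat \<Rightarrow> nat rel \<Rightarrow> nat \<Rightarrow> nat \<Rightarrow> cpoly \<Rightarrow> cpoly" where
  "second_eigenvalue n P a b f =
     (if coef f a \<noteq> 0 \<longleftrightarrow> coef f b \<noteq> 0
      then (\<Sum>k | k \<in> {1..n} \<and> (k, b) \<notin> P. const (coef f k) * var k)
         - (\<Sum>k | k \<in> {1..n} \<and> (k, a) \<in> P \<and> k \<noteq> a. const (coef f k) * var k)
      else f - const (coef f b) * var b + const (coef f b) * var a)"

end

theory Submission
  imports Defs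
begin

text \<open>Let \<open>\<sigma>\<close> exchange the letters \<open>a\<close> and \<open>b\<close>.  The linear extensions of \<open>P'\<close> are those of \<open>P\<close> together with
  their images under \<open>\<sigma>\<close>.  Promoting a linear extension of \<open>P\<close> from a letter not weakly below \<open>a\<close> has the
  same result in \<open>P\<close> and in \<open>P'\<close>, while starting weakly below \<open>a\<close> the results differ exactly by \<open>\<sigma>\<close>.
  Writing \<open>O\<close> and \<open>Q\<close> for the sums of \<open>x\<^sub>k G\<^sub>k\<close> over \<open>k\<close> not weakly below \<open>b\<close> and over \<open>k\<close> strictly below \<open>a\<close>, the matrix
  of \<open>P'\<close> therefore consists of the blocks \<open>O + x\<^sub>b G\<^sub>b\<close>, \<open>Q + x\<^sub>a G\<^sub>a\<close> in the first row and \<open>Q + x\<^sub>b G\<^sub>a\<close>,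
  \<open>O + x\<^sub>a G\<^sub>b\<close> in the second.  After simultaneous triangularization each index \<open>s\<close> contributes a matrix
  of size two built from the diagonal entries \<open>c\<^sub>k\<close> of the \<open>G\<^sub>k\<close>: by the upset property either \<open>c\<^sub>a = c\<^sub>b\<close>,
  and \<open>(1, 1)\<close> is an eigenvector of it, or \<open>c\<^sub>k = 0\<close> for all \<open>k\<close> weakly below \<open>a\<close>, and it is diagonal.\<close>

section \<open>Characteristic polynomials of block matrices\<close>

text \<open>A permutation contributing to the Leibniz sum must raise \<open>\<rho>\<close> at every
  index that it moves, yet it leaves the total of \<open>\<rho>\<close> unchanged; so only the
  identity contributes. The rank function allows rows and columns to be interleaved without
  permuting the matrix.\<close>

lemma det_rank_triangular:
  fixes A :: "'a :: comm_ring_1 mat" and \<rho> :: "nat \<Rightarrow> nat"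
  assumes A: "A \<in> carrier_mat m m"
    and tri: "\<And>i j. i < m \<Longrightarrow> j < m \<Longrightarrow> i \<noteq> j \<Longrightarrow> \<not> \<rho> i < \<rho> j \<Longrightarrow> A $$ (i, j) = 0"
  shows "det A = (\<Prod>i = 0..<m. A $$ (i, i))"
proof -
  have zero: "(\<Prod>i = 0..<m. A $$ (i, p i)) = 0" if p: "p permutes {0..<m}" and "p \<noteq> id" for p
  proof (rule ccontr)
    assume nz: "(\<Prod>i = 0..<m. A $$ (i, p i)) \<noteq> 0"
    have lt: "p i = i \<or> \<rho> i < \<rho> (p i)" if "i < m" for i
    proof (rule ccontr)
      assume "\<not> ?thesis"
      moreover have "p i < m" using permutes_in_image[OF p, of i] that by simp
      ultimately have "A $$ (i, p i) = 0" using tri[of i "p i"] that by auto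
      then show False using nz that prod_zero[of "{0..<m}" "\<lambda>i. A $$ (i, p i)"] by force
    qed
    obtain k where "k < m" "p k \<noteq> k"
      using permutes_not_in[OF p] \<open>p \<noteq> id\<close> by (metis atLeastLessThan_iff eq_id_iff zero_le)
    then have "(\<Sum>i = 0..<m. \<rho> i) < (\<Sum>i = 0..<m. \<rho> (p i))"
      using lt by (intro sum_strict_mono_ex1) (force intro: less_imp_le)+
    then show False using sum.permute[OF p, of \<rho>] by (simp add: o_def)
  qed
  have "det A = (\<Sum>p | p permutes {0..<m}.
      if p = id then signof p * (\<Prod>i = 0..<m. A $$ (i, p i)) else 0)"
    unfolding det_def'[OF A] using zero by (intro sum.cong) auto
  also have "\<dots> = (\<Prod>i = 0..<m. A $$ (i, i))"
    by (simp add: finite_permutations permutes_id)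
  finally show ?thesis .
qed

lemma char_poly_matrix_index:
  assumes "A \<in> carrier_mat m m" "i < m" "j < m"
  shows "char_poly_matrix A $$ (i, j) = (if i = j then [:- (A $$ (i, j)), 1:] else [:- (A $$ (i, j)):])"
  using assms by (auto simp: char_poly_matrix_def)

lemma char_poly_rank_triangular:
  fixes A :: "'a :: comm_ring_1 mat" and \<rho> :: "nat \<Rightarrow> nat"
  assumes A: "A \<in> carrier_mat m m"
    and tri: "\<And>i j. i < m \<Longrightarrow> j < m \<Longrightarrow> i \<noteq> j \<Longrightarrow> \<not> \<rho> i < \<rho> j \<Longrightarrow> A $$ (i, j) = 0"
  shows "char_poly A = (\<Prod>i = 0..<m. [:- (A $$ (i, i)), 1:])"
proof -
  have "char_poly A = (\<Prod>i = 0..<m. char_poly_matrix A $$ (i, i))"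
    unfolding char_poly_def
    by (rule det_rank_triangular[where \<rho> = \<rho>])
      (use A tri in \<open>auto simp: char_poly_matrix_index[OF A]\<close>)
  then show ?thesis using A by (simp add: char_poly_matrix_index[OF A])
qed

section \<open>Reordering rows and columns simultaneously\<close>

lemma det_permute:
  fixes A :: "'a :: comm_ring_1 mat"
  assumes A: "A \<in> carrier_mat m m" and p: "p permutes {0..<m}"
  shows "det (mat m m (\<lambda>(i, j). A $$ (p i, p j))) = det A"
proof -
  have p_less: "p i < m" if "i < m" for i
    using permutes_in_image[OF p, of i] that by simp
  \<comment> \<open>Transposing turns the column permutation into a second row permutation; the two
    signs cancel.\<close>
  define B where "B = transpose_mat (mat m m (\<lambda>(i, j). A $$ (p i, j)))"
  have B: "B \<in> carrier_mat m m" by (simp add: B_def)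
  have "mat m m (\<lambda>(i, j). A $$ (p i, p j)) = transpose_mat (mat m m (\<lambda>(i, j). B $$ (p i, j)))"
    by (rule eq_matI) (auto simp: B_def p_less)
  then have "det (mat m m (\<lambda>(i, j). A $$ (p i, p j))) = signof p * det B"
    using det_transpose[of "mat m m (\<lambda>(i, j). B $$ (p i, j))" m] det_permute_rows[OF B p] by simp
  also have "det B = signof p * det A"
    unfolding B_def using det_transpose[of "mat m m (\<lambda>(i, j). A $$ (p i, j))" m]
      det_permute_rows[OF A p] by simp
  finally show ?thesis
    by (simp add: sign_def)
qed

lemma char_poly_permute:
  fixes A :: "'a :: comm_ring_1 mat"
  assumes A: "A \<in> carrier_mat m m" and p: "p permutes {0..<m}"
  shows "char_poly (mat m m (\<lambda>(i, j). A $$ (p i, p j))) = char_poly A"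
proof -
  let ?B = "mat m m (\<lambda>(i, j). A $$ (p i, p j))"
  have p_less: "p i < m" if "i < m" for i
    using permutes_in_image[OF p, of i] that by simp
  have p_eq: "p i = p j \<longleftrightarrow> i = j" for i j
    using permutes_inj[OF p] by (auto dest: injD)
  have "char_poly_matrix ?B = mat m m (\<lambda>(i, j). char_poly_matrix A $$ (p i, p j))"
    by (rule eq_matI) (auto simp: char_poly_matrix_index[OF A] char_poly_matrix_index[where m = m]
        char_poly_matrix_closed[THEN carrier_matD(1)] char_poly_matrix_closed[THEN carrier_matD(2)] p_less p_eq)
  then show ?thesis
    unfolding char_poly_def using det_permute[OF char_poly_matrix_closed[OF A] p] by simp
qed

text \<open>The order in which an index set is listed does not affect the characteristic polynomial.
  This frees the matrix of \<open>P'\<close> from the order chosen by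
  \<open>lin_ext_list\<close>.\<close>

lemma char_poly_mset_cong:
  fixes F :: "'b \<Rightarrow> 'b \<Rightarrow> 'a :: comm_ring_1"
  assumes "mset K = mset L"
  shows "char_poly (mat (length K) (length K) (\<lambda>(i, j). F (K ! i) (K ! j))) =
    char_poly (mat (length L) (length L) (\<lambda>(i, j). F (L ! i) (L ! j)))"
proof -
  obtain p where p: "p permutes {..<length L}" and K: "permute_list p L = K"
    using mset_eq_permutation[OF assms] .
  have p': "p permutes {0..<length L}" using p by (simp add: atLeast0LessThan)
  have p_less: "p i < length L" if "i < length L" for i
    using permutes_in_image[OF p, of i] that by simp
  let ?L = "mat (length L) (length L) (\<lambda>(i, j). F (L ! i) (L ! j))"
  have "mat (length K) (length K) (\<lambda>(i, j). F (K ! i) (K ! j)) =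
      mat (length L) (length L) (\<lambda>(i, j). ?L $$ (p i, p j))"
    using K by (intro eq_matI) (auto simp: permute_list_nth[OF p] p_less)
  then show ?thesis using char_poly_permute[OF _ p', of ?L] by simp
qed

text \<open>The rank places the two copies of each index \<open>s\<close> next to each other. Within
  such a pair only the diagonal entry of \<open>C\<close> sits below the diagonal, and it
  vanishes.\<close>

lemma char_poly_block_triangular:
  fixes A B C D :: "'a :: comm_ring_1 mat"
  assumes "A \<in> carrier_mat N N" "B \<in> carrier_mat N N" "C \<in> carrier_mat N N" "D \<in> carrier_mat N N"
    and ut: "\<And>M i j. M \<in> {A, B, C, D} \<Longrightarrow> j < i \<Longrightarrow> i < N \<Longrightarrow> M $$ (i, j) = 0"
    and C0: "\<And>i. i < N \<Longrightarrow> C $$ (i, i) = 0"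
  shows "char_poly (four_block_mat A B C D) =
    (\<Prod>s = 0..<N. [:- (A $$ (s, s)), 1:] * [:- (D $$ (s, s)), 1:])"
proof -
  let ?M = "four_block_mat A B C D"
  let ?\<rho> = "\<lambda>i. if i < N then 2 * i else 2 * (i - N) + 1"
  have dim: "dim_row A = N" "dim_col A = N" "dim_row B = N" "dim_col B = N" "dim_row C = N"
    "dim_col C = N" "dim_row D = N" "dim_col D = N"
    using assms(1-4) by (blast dest: carrier_matD)+
  have C: "C $$ (i, j) = 0" if "j \<le> i" "i < N" for i j
    using that ut[of C j i] C0[of i] by (cases "i = j") auto
  have "char_poly ?M = (\<Prod>i = 0..<N + N. [:- (?M $$ (i, i)), 1:])"
    by (rule char_poly_rank_triangular[where \<rho> = ?\<rho>])
      (auto simp: dim ut C split: if_splits)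
  also have "\<dots> = (\<Prod>i = 0..<N. [:- (?M $$ (i, i)), 1:]) * (\<Prod>i = N..<N + N. [:- (?M $$ (i, i)), 1:])"
    by (simp add: prod.atLeastLessThan_concat)
  also have "(\<Prod>i = N..<N + N. [:- (?M $$ (i, i)), 1:]) = (\<Prod>s = 0..<N. [:- (D $$ (s, s)), 1:])"
    using prod.shift_bounds_nat_ivl[of "\<lambda>i. [:- (?M $$ (i, i)), 1:]" 0 N N] by (simp add: dim)
  finally show ?thesis unfolding prod.distrib by (simp add: dim)
qed

text \<open>The hypothesis on \<open>e\<close> says that \<open>(1, e s)\<close> is an eigenvector
  of the matrix of size two formed by the diagonal entries at \<open>s\<close>. Its eigenvalue is
  \<open>A + B e\<close>, and the trace leaves \<open>D - e B\<close> for the other one.\<close>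

lemma char_poly_block_of_triangular:
  fixes A B C D :: "'a :: comm_ring_1 mat" and e :: "nat \<Rightarrow> 'a"
  assumes carrier: "A \<in> carrier_mat N N" "B \<in> carrier_mat N N" "C \<in> carrier_mat N N" "D \<in> carrier_mat N N"
    and ut: "\<And>M i j. M \<in> {A, B, C, D} \<Longrightarrow> j < i \<Longrightarrow> i < N \<Longrightarrow> M $$ (i, j) = 0"
    and e: "\<And>s. s < N \<Longrightarrow> C $$ (s, s) + D $$ (s, s) * e s = e s * (A $$ (s, s) + B $$ (s, s) * e s)"
  shows "char_poly (four_block_mat A B C D) =
    (\<Prod>s = 0..<N. [:- (A $$ (s, s) + B $$ (s, s) * e s), 1:] * [:- (D $$ (s, s) - e s * B $$ (s, s)), 1:])"
proof -
  note dims = carrier[THEN carrier_matD(1)] carrier[THEN carrier_matD(2)]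
  txt \<open>Conjugating by the block matrix with rows \<open>1, 0\<close> and \<open>E, 1\<close>, \<open>E = diag e\<close>, kills the diagonal of the
    lower left block.  The rows and columns can then be interleaved to a triangular matrix.\<close>
  define E where "E = mat N N (\<lambda>(i, j). if i = j then e i else 0)"
  have E: "E \<in> carrier_mat N N" and nE: "- E \<in> carrier_mat N N" by (auto simp: E_def)
  have right: "(M * E) $$ (i, j) = M $$ (i, j) * e j" if "M \<in> carrier_mat N N" "i < N" "j < N" for M i j
  proof -
    have "(M * E) $$ (i, j) = (\<Sum>k = 0..<N. M $$ (i, k) * (if k = j then e k else 0))"
      using that by (simp add: E_def scalar_prod_def)
    also have "\<dots> = M $$ (i, j) * e j" using that by (simp add: if_distrib cong: if_cong)
    finally show ?thesis .
  qed
  have left: "(E * M) $$ (i, j) = e i * M $$ (i, j)" if "M \<in> carrier_mat N N" "i < N" "j < N" for M i j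
  proof -
    have "(E * M) $$ (i, j) = (\<Sum>k = 0..<N. (if i = k then e i else 0) * M $$ (k, j))"
      using that by (simp add: E_def scalar_prod_def)
    also have "\<dots> = e i * M $$ (i, j)" using that by (simp add: if_distrib if_distribR cong: if_cong)
    finally show ?thesis .
  qed
  let ?M = "four_block_mat A B C D"
  let ?T = "four_block_mat (1\<^sub>m N) (0\<^sub>m N N) E (1\<^sub>m N)"
  let ?T' = "four_block_mat (1\<^sub>m N) (0\<^sub>m N N) (- E) (1\<^sub>m N)"
  \<comment> \<open>These blocks are forced by the equation \<open>?M * ?T = ?T * ?X\<close>; the
    diagonal of \<open>C'\<close> is zero by the hypothesis on \<open>e\<close>.\<close>
  define A' where "A' = A + B * E"
  define D' where "D' = D - E * B"
  define C' where "C' = C + D * E - E * A'"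
  have A': "A' \<in> carrier_mat N N" and D': "D' \<in> carrier_mat N N" and C': "C' \<in> carrier_mat N N"
    using carrier E by (auto simp: A'_def D'_def C'_def)
  let ?X = "four_block_mat A' B C' D'"
  have EA': "E * A' \<in> carrier_mat N N" using E A' by simp
  have T: "?T \<in> carrier_mat (N + N) (N + N)" "?T' \<in> carrier_mat (N + N) (N + N)"
    using E by auto
  have M: "?M \<in> carrier_mat (N + N) (N + N)" and X: "?X \<in> carrier_mat (N + N) (N + N)"
    using carrier A' D' by auto
  have TT': "?T * ?T' = 1\<^sub>m (N + N)"
    by (subst mult_four_block_mat[OF _ _ E _ _ _ nE], use E in \<open>auto intro!: eq_matI\<close>)
  have T'T: "?T' * ?T = 1\<^sub>m (N + N)"
    by (subst mult_four_block_mat[OF _ _ nE _ _ _ E], use E in \<open>auto intro!: eq_matI\<close>)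
  have MT: "?M * ?T = four_block_mat A' B (C + D * E) D"
    by (subst mult_four_block_mat[OF carrier(1,2,3,4) _ _ E], use carrier E in \<open>auto simp: A'_def\<close>)
  have TX: "?T * ?X = four_block_mat A' B (E * A' + C') (E * B + D')"
    by (subst mult_four_block_mat[OF _ _ E _ A' carrier(2) C' D'], use carrier E A' C' D' in auto)
  have "E * A' + C' = C + D * E"
    using EA' carrier E by (intro eq_matI) (auto simp: C'_def simp del: index_mult_mat(1))
  moreover have "E * B + D' = D"
    using carrier E by (intro eq_matI) (auto simp: D'_def simp del: index_mult_mat(1))
  ultimately have comm: "?M * ?T = ?T * ?X" unfolding MT TX by simp
  have "?M = ?T * ?X * ?T'"
    unfolding comm[symmetric] assoc_mult_mat[OF M T] TT' by (rule right_mult_one_mat[OF M, symmetric])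
  then have "similar_mat ?M ?X"
    using M X T TT' T'T by (intro similar_matI[where P = ?T and Q = ?T' and n = "N + N"]) blast+
  then have "char_poly ?M = char_poly ?X" by (rule char_poly_similar)
  also have "\<dots> = (\<Prod>s = 0..<N. [:- (A' $$ (s, s)), 1:] * [:- (D' $$ (s, s)), 1:])"
  proof (rule char_poly_block_triangular[OF A' carrier(2) C' D'])
    have A'_index: "A' $$ (i, j) = A $$ (i, j) + B $$ (i, j) * e j" if "i < N" "j < N" for i j
      using that carrier E by (simp add: A'_def right del: index_mult_mat(1))
    have C'_index: "C' $$ (i, j) = C $$ (i, j) + D $$ (i, j) * e j - e i * A' $$ (i, j)"
      if "i < N" "j < N" for i j
      using that carrier E A' by (simp add: C'_def right left del: index_mult_mat(1))
    have D'_index: "D' $$ (i, j) = D $$ (i, j) - e i * B $$ (i, j)" if "i < N" "j < N" for i j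
      using that carrier E by (simp add: D'_def left del: index_mult_mat(1))
    show "M $$ (i, j) = 0" if "M \<in> {A', B, C', D'}" "j < i" "i < N" for M i j
      using that ut[of A j i] ut[of B j i] ut[of C j i] ut[of D j i]
      by (auto simp: A'_index C'_index D'_index)
    show "C' $$ (i, i) = 0" if "i < N" for i
      using that e by (simp add: A'_index C'_index)
  qed
  also have "\<dots> = (\<Prod>s = 0..<N. [:- (A $$ (s, s) + B $$ (s, s) * e s), 1:] *
      [:- (D $$ (s, s) - e s * B $$ (s, s)), 1:])"
    using carrier E
    by (intro prod.cong refl) (simp add: A'_def D'_def left right del: index_mult_mat(1))
  finally show ?thesis .
qed

section \<open>Linear extensions and promotion\<close>

lemma lin_exts_iff:
  "w \<in> lin_exts n P \<longleftrightarrow> distinct w \<and> set w = {1..n} \<and>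
     (\<forall>i<n. \<forall>j<n. (w ! i, w ! j) \<in> P \<and> w ! i \<noteq> w ! j \<longrightarrow> i < j)"
proof -
  have "(\<forall>i\<in>{1..n}. \<forall>j\<in>{1..n}. (w ! (i - 1), w ! (j - 1)) \<in> P \<and> w ! (i - 1) \<noteq> w ! (j - 1) \<longrightarrow> i < j) \<longleftrightarrow>
     (\<forall>i<n. \<forall>j<n. (w ! i, w ! j) \<in> P \<and> w ! i \<noteq> w ! j \<longrightarrow> i < j)" (is "?l \<longleftrightarrow> ?r")
  proof
    assume l: ?l
    show ?r
    proof (intro allI impI)
      fix i j assume "i < n" "j < n" "(w ! i, w ! j) \<in> P \<and> w ! i \<noteq> w ! j"
      then show "i < j" using l[rule_format, of "Suc i" "Suc j"] by simp
    qed
  next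
    assume r: ?r
    show ?l
    proof (intro ballI impI)
      fix i j assume "i \<in> {1..n}" "j \<in> {1..n}" "(w ! (i - 1), w ! (j - 1)) \<in> P \<and> w ! (i - 1) \<noteq> w ! (j - 1)"
      then show "i < j" using r[rule_format, of "i - 1" "j - 1"] by force
    qed
  qed
  then show ?thesis unfolding lin_exts_def by auto
qed

lemma lin_ext_less:
  "w \<in> lin_exts n P \<Longrightarrow> i < n \<Longrightarrow> j < n \<Longrightarrow> (w ! i, w ! j) \<in> P \<Longrightarrow> w ! i \<noteq> w ! j \<Longrightarrow> i < j"
  unfolding lin_exts_iff by blast

lemma length_lin_ext: "w \<in> lin_exts n P \<Longrightarrow> length w = n"
  using distinct_card[of w] by (simp add: lin_exts_def)

text \<open>An exchange of neighbours reverses the relative order of no other pair, and it takes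
  place only if the two are incomparable.\<close>

lemma \<tau>_lin_ext:
  assumes w: "w \<in> lin_exts n P" and i: "0 < i" "i < n"
  shows "\<tau> P i w \<in> lin_exts n P"
proof (cases "(w ! (i - 1), w ! i) \<notin> P \<and> (w ! i, w ! (i - 1)) \<notin> P")
  case True
  have len: "length w = n" using w by (rule length_lin_ext)
  let ?w = "w[i - 1 := w ! i, i := w ! (i - 1)]"
  have nth: "?w ! k = w ! transpose (i - 1) i k" if "k < n" for k
    using that i len by (auto simp: transpose_def nth_list_update)
  have less: "transpose (i - 1) i k < n" if "k < n" for k
    using that i by (auto simp: transpose_def)
  have "k < l" if kl: "k < n" "l < n" "(?w ! k, ?w ! l) \<in> P" "?w ! k \<noteq> ?w ! l" for k l
  proof (rule ccontr)
    assume "\<not> k < l"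
    have "transpose (i - 1) i k < transpose (i - 1) i l"
      using w kl less unfolding lin_exts_iff nth[OF kl(1)] nth[OF kl(2)] by blast
    then have "k = i" "l = i - 1"
      using \<open>\<not> k < l\<close> i by (auto simp: transpose_def split: if_splits)
    then show False using True kl(3) unfolding nth[OF kl(1)] nth[OF kl(2)] by simp
  qed
  moreover have "distinct ?w" "set ?w = {1..n}"
    using w i len distinct_swap[of i w "i - 1"] set_swap[of i w "i - 1"]
    by (auto simp: lin_exts_iff list_update_swap)
  ultimately show ?thesis using True unfolding \<tau>_def lin_exts_iff by simp
qed (use w in \<open>auto simp: \<tau>_def\<close>)


lemma \<tau>_map:
  assumes "i < length w"
    and "\<And>x y. (f x, f y) \<in> P \<longleftrightarrow> (x, y) \<in> P"
  shows "\<tau> P i (map f w) = map f (\<tau> P i w)"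
  using assms by (simp add: \<tau>_def map_update)

lemma fold_\<tau>_lin_ext:
  assumes "w \<in> lin_exts n P" "0 < i" "j \<le> n"
  shows "fold (\<tau> P) [i..<j] w \<in> lin_exts n P"
  using assms(3)
proof (induction j)
  case (Suc j)
  then show ?case using \<tau>_lin_ext[of "fold (\<tau> P) [i..<j] w" n P j] assms by (cases "i \<le> j") auto
qed (use assms in auto)

lemma promotion_lin_ext:
  "w \<in> lin_exts n P \<Longrightarrow> 0 < i \<Longrightarrow> promotion n P i w \<in> lin_exts n P"
  unfolding promotion_def by (rule fold_\<tau>_lin_ext) auto

text \<open>Each stage only consults comparabilities, which \<open>f\<close> preserves and reflects.
  The intended case is \<open>P'\<close> with the swap of \<open>a\<close> and
  \<open>b\<close>.\<close>

lemma promotion_map: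
  assumes "w \<in> lin_exts n P" "0 < i"
    and "\<And>x y. (f x, f y) \<in> P \<longleftrightarrow> (x, y) \<in> P"
  shows "promotion n P i (map f w) = map f (promotion n P i w)"
proof -
  have "fold (\<tau> P) [i..<j] (map f w) = map f (fold (\<tau> P) [i..<j] w)" if "j \<le> n" for j
    using that
  proof (induction j)
    case (Suc j)
    then show ?case
      using \<tau>_map[of j "fold (\<tau> P) [i..<j] w" f P] assms
        length_lin_ext[OF fold_\<tau>_lin_ext[OF assms(1,2), of j]] by (cases "i \<le> j") auto
  qed simp
  then show ?thesis by (simp add: promotion_def)
qed

text \<open>An element strictly between two neighbouring letters would need a position strictly
  between theirs. Hence comparable neighbours form a covering pair.\<close>

lemma lin_ext_adjacent:
  assumes u: "u \<in> lin_exts n P" and j: "0 < j" "j < n"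
  shows lin_ext_adjacent_neq: "u ! (j - 1) \<noteq> u ! j"
    and lin_ext_adjacent_notin: "(u ! j, u ! (j - 1)) \<notin> P"
    and lin_ext_adjacent_cover: "z \<in> {1..n} \<Longrightarrow> (u ! (j - 1), z) \<in> P \<Longrightarrow> (z, u ! j) \<in> P \<Longrightarrow>
      z = u ! (j - 1) \<or> z = u ! j"
proof -
  have len: "length u = n" and dist: "distinct u" and set: "set u = {1..n}"
    using u length_lin_ext by (auto simp: lin_exts_iff)
  have before: "k < l" if "k < n" "l < n" "(u ! k, u ! l) \<in> P" "u ! k \<noteq> u ! l" for k l
    using u that unfolding lin_exts_iff by blast
  show neq: "u ! (j - 1) \<noteq> u ! j"
    using dist len j by (simp add: nth_eq_iff_index_eq)
  show "(u ! j, u ! (j - 1)) \<notin> P"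
  proof
    assume "(u ! j, u ! (j - 1)) \<in> P"
    then have "j < j - 1" using before[of j "j - 1"] neq j by simp
    then show False by simp
  qed
  show "z = u ! (j - 1) \<or> z = u ! j"
    if z: "z \<in> {1..n}" and between: "(u ! (j - 1), z) \<in> P" "(z, u ! j) \<in> P"
  proof (rule ccontr)
    obtain k where k: "k < n" "z = u ! k" using z set len by (metis in_set_conv_nth)
    assume "\<not> ?thesis"
    then have "j - 1 < k" "k < j"
      using before[of "j - 1" k] before[of k j] between j k by auto
    then show False by simp
  qed
qed

section \<open>The pairs of \<open>R_pairs\<close>\<close>

text \<open>A pair \<open>c \<prec> d\<close> lies in \<open>R_pairs P\<close> iff the elements weakly below \<open>c\<close> or weakly above \<open>d\<close> form a union of
  components; they are \<open>Q', c, d, Q''\<close>, and the remaining elements form \<open>P2\<close>.\<close>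

definition ordinal_cover :: "'a rel \<Rightarrow> 'a \<Rightarrow> 'a \<Rightarrow> bool" where
  "ordinal_cover P c d \<longleftrightarrow> c \<noteq> d \<and> (c, d) \<in> P \<and>
     (\<forall>x y. (x, y) \<in> P \<longrightarrow> ((x, c) \<in> P \<or> (d, x) \<in> P \<longleftrightarrow> (y, c) \<in> P \<or> (d, y) \<in> P))"

text \<open>In the given form, the elements weakly below \<open>c\<close> are \<open>Q'\<close> and
  \<open>c\<close>, those weakly above \<open>d\<close> are \<open>Q''\<close> and \<open>d\<close>,
  and no relation connects them with \<open>P2\<close>.\<close>

lemma has_form_ordinal_cover:
  assumes "has_form P Q' c d Q'' P2"
  shows "ordinal_cover P c d"
proof -
  have P: "P = Q' \<union> {(c, c), (d, d)} \<union> Q'' \<union> P2 \<union> {(c, d)} \<union> {c, d} \<times> Field Q''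
      \<union> Field Q' \<times> ({c, d} \<union> Field Q'')"
    using assms unfolding has_form_def direct_sum_def ordinal_sum_def[of Q'] Field_ordinal_sum Field_point
    unfolding ordinal_sum_def[of "point c"] Field_ordinal_sum Field_point
    unfolding ordinal_sum_def Field_point unfolding point_def by blast
  have fields: "c \<noteq> d" "c \<notin> Field Q' \<union> Field Q'' \<union> Field P2" "d \<notin> Field Q' \<union> Field Q'' \<union> Field P2"
    "Field Q' \<inter> Field Q'' = {}" "Field Q' \<inter> Field P2 = {}" "Field Q'' \<inter> Field P2 = {}"
    using assms unfolding has_form_def by blast+
  have P_iff: "(x, y) \<in> P \<longleftrightarrow> (x, y) \<in> Q' \<or> (x, y) \<in> Q'' \<or> (x, y) \<in> P2 \<or> x = c \<and> y = c \<or>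
      x = d \<and> y = d \<or> x = c \<and> y = d \<or> (x = c \<or> x = d) \<and> y \<in> Field Q'' \<or>
      x \<in> Field Q' \<and> (y = c \<or> y = d \<or> y \<in> Field Q'')" for x y
    unfolding P by auto
  have below: "(x, c) \<in> P \<longleftrightarrow> x \<in> Field Q' \<or> x = c" for x
    unfolding P_iff using fields by (auto intro: FieldI1 FieldI2)
  have above: "(d, x) \<in> P \<longleftrightarrow> x \<in> Field Q'' \<or> x = d" for x
    unfolding P_iff using fields by (auto intro: FieldI1 FieldI2)
  have "(x \<in> Field Q' \<or> x = c) \<or> (x \<in> Field Q'' \<or> x = d) \<longleftrightarrow>
      (y \<in> Field Q' \<or> y = c) \<or> (y \<in> Field Q'' \<or> y = d)" if "(x, y) \<in> P" for x y
    using that fields FieldI1[of x y Q'] FieldI2[of x y Q'] FieldI1[of x y Q''] FieldI2[of x y Q'']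
      FieldI1[of x y P2] FieldI2[of x y P2]
    unfolding P_iff by (elim disjE) auto
  moreover have "(c, d) \<in> P" unfolding P by blast
  ultimately show ?thesis using fields unfolding ordinal_cover_def below above by blast
qed

lemma ordinal_cover_has_form:
  assumes po: "Partial_order P" and cover: "ordinal_cover P c d"
  shows "\<exists>Q' Q'' P2. has_form P Q' c d Q'' P2"
proof -
  have refl: "(x, x) \<in> P" if "x \<in> Field P" for x
    using po that by (auto simp: order_on_defs refl_on_def)
  have trans: "(x, z) \<in> P" if "(x, y) \<in> P" "(y, z) \<in> P" for x y z
    using po that unfolding order_on_defs trans_def by blast
  have antisym: "x = y" if "(x, y) \<in> P" "(y, x) \<in> P" for x y
    using po that unfolding order_on_defs antisym_def by blast
  have in_Field: "x \<in> Field P \<and> y \<in> Field P" if "(x, y) \<in> P" for x y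
    using that by (auto simp: Field_def)
  have cd: "c \<noteq> d" "(c, d) \<in> P" and
    comp: "\<And>x y. (x, y) \<in> P \<Longrightarrow> (x, c) \<in> P \<or> (d, x) \<in> P \<longleftrightarrow> (y, c) \<in> P \<or> (d, y) \<in> P"
    using cover unfolding ordinal_cover_def by blast+
  define A where "A = {k. (k, c) \<in> P \<and> k \<noteq> c}"
  define B where "B = {k. (d, k) \<in> P \<and> k \<noteq> d}"
  define C where "C = {k \<in> Field P. (k, c) \<notin> P \<and> (d, k) \<notin> P}"
  have Refl: "Refl P" using po by (simp add: order_on_defs)
  have sub: "A \<subseteq> Field P" "B \<subseteq> Field P" "C \<subseteq> Field P"
    using in_Field by (auto simp: A_def B_def C_def)
  have Fields: "Field (Restr P A) = A" "Field (Restr P B) = B" "Field (Restr P C) = C"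
    using Refl_Field_Restr2[OF Refl] sub by auto
  have "P = Restr P A \<union> {(c, c), (d, d)} \<union> Restr P B \<union> Restr P C \<union> {(c, d)} \<union> {c, d} \<times> B
      \<union> A \<times> ({c, d} \<union> B)" (is "P = ?R")
  proof
    show "?R \<subseteq> P"
    proof
      fix z assume "z \<in> ?R"
      then show "z \<in> P"
        using cd refl[of c] refl[of d] in_Field[OF cd(2)]
        by (auto simp: A_def B_def intro: trans[of _ c d] trans[of c d] trans[of _ c] trans[of _ d])
    qed
    show "P \<subseteq> ?R"
    proof
      fix z assume "z \<in> P"
      then obtain x y where z: "z = (x, y)" and xy: "(x, y) \<in> P" by (cases z) auto
      show "z \<in> ?R"
      proof (cases "(x, c) \<in> P \<or> (d, x) \<in> P")
        case True
        then have y: "(y, c) \<in> P \<or> (d, y) \<in> P" using comp[OF xy] by simp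
        \<comment> \<open>A relation from above \<open>d\<close> to below \<open>c\<close> would put
          \<open>d\<close> weakly below \<open>c\<close>, against antisymmetry.\<close>
        have "\<not> ((d, x) \<in> P \<and> (y, c) \<in> P)" using xy cd trans antisym by blast
        moreover have "x = c" if "y = c" "(x, c) \<notin> P \<or> x = c" using that xy by auto
        ultimately show ?thesis using True y xy cd antisym[of x d] antisym[of y c]
          unfolding z A_def B_def by auto
      next
        case False
        then show ?thesis using comp[OF xy] xy in_Field[OF xy] unfolding z C_def by auto
      qed
    qed
  qed
  also have "\<dots> = Restr P A [\<oplus>] point c [\<oplus>] point d [\<oplus>] Restr P B [+] Restr P C"
    unfolding direct_sum_def ordinal_sum_def[of "Restr P A"] Field_ordinal_sum Field_point Fields
    unfolding ordinal_sum_def[of "point c"] Field_ordinal_sum Field_point Fields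
    unfolding ordinal_sum_def Field_point Fields unfolding point_def by blast
  finally have P: "P = Restr P A [\<oplus>] point c [\<oplus>] point d [\<oplus>] Restr P B [+] Restr P C" .
  have "A \<inter> B = {}" using trans[of d _ c] antisym[of c d] cd unfolding A_def B_def by auto
  moreover have "A \<inter> C = {}" "B \<inter> C = {}" unfolding A_def B_def C_def by blast+
  moreover have "c \<notin> A \<union> B \<union> C" "d \<notin> A \<union> B \<union> C"
    using cd refl[of c] refl[of d] in_Field[OF cd(2)] antisym[of c d] unfolding A_def B_def C_def by auto
  ultimately have "has_form P (Restr P A) c d (Restr P B) (Restr P C)"
    unfolding has_form_def Fields using cd P Partial_order_Restr[OF po, of A] Partial_order_Restr[OF po, of B]
      Partial_order_Restr[OF po, of C]
    unfolding Fields by (intro conjI) auto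
  then show ?thesis by blast
qed

lemma R_pairs_iff:
  "Partial_order P \<Longrightarrow> (c, d) \<in> R_pairs P \<longleftrightarrow> ordinal_cover P c d"
  unfolding R_pairs_def by (auto dest: has_form_ordinal_cover ordinal_cover_has_form)

section \<open>Dropping the relation\<close>

text \<open>Assuming the form-free condition \<open>ordinal_cover\<close> makes it easy to interpret
  the locale a second time, for another pair of \<open>R_pairs P\<close>.\<close>

locale ordinal_cover_poset =
  fixes n :: nat and P :: "nat rel" and a b :: nat
  assumes po: "partial_order_on {1..n} P" and cover: "ordinal_cover P a b"
begin

abbreviation P' :: "nat rel" where "P' \<equiv> P - {(a, b)}"
abbreviation \<sigma> :: "nat \<Rightarrow> nat" where "\<sigma> \<equiv> transpose a b"

lemma ab: "a \<noteq> b" "(a, b) \<in> P"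
  using cover by (auto simp: ordinal_cover_def)

lemma in_range: "(x, y) \<in> P \<Longrightarrow> x \<in> {1..n} \<and> y \<in> {1..n}"
  using po unfolding order_on_defs refl_on_def by blast

lemma P_refl: "x \<in> {1..n} \<Longrightarrow> (x, x) \<in> P"
  using po unfolding order_on_defs refl_on_def by blast

lemma P_trans: "(x, y) \<in> P \<Longrightarrow> (y, z) \<in> P \<Longrightarrow> (x, z) \<in> P"
  using po unfolding order_on_defs trans_def by blast

lemma P_antisym: "(x, y) \<in> P \<Longrightarrow> (y, x) \<in> P \<Longrightarrow> x = y"
  using po unfolding order_on_defs antisym_def by blast

lemma ab_range: "a \<in> {1..n}" "b \<in> {1..n}" and ab_refl: "(a, a) \<in> P" "(b, b) \<in> P"
  and ba: "(b, a) \<notin> P"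
  using in_range[OF ab(2)] P_refl P_antisym ab by auto

lemma component: "(x, y) \<in> P \<Longrightarrow> (x, a) \<in> P \<or> (b, x) \<in> P \<longleftrightarrow> (y, a) \<in> P \<or> (b, y) \<in> P"
  using cover unfolding ordinal_cover_def by blast

text \<open>\<open>component\<close> leaves only elements weakly below \<open>a\<close> or weakly
  above \<open>b\<close> as candidates for \<open>x\<close>, and of the latter only \<open>b\<close>
  itself is weakly below \<open>b\<close>.\<close>

lemma below_b: "(x, b) \<in> P \<longleftrightarrow> x = b \<or> (x, a) \<in> P"
  using component[of x b] ab_refl ab P_trans[of x a b] P_antisym[of x b] by blast

lemma above_a: "(a, x) \<in> P \<longleftrightarrow> x = a \<or> (b, x) \<in> P"
  using component[of a x] ab_refl ab P_trans[of a b x] P_antisym[of a x] by blast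

text \<open>By \<open>below_b\<close> and \<open>above_a\<close>, the elements \<open>a\<close> and
  \<open>b\<close> have the same strict lower bounds and the same strict upper bounds in
  \<open>P'\<close>; exchanging them is therefore an automorphism.\<close>

lemma P'_\<sigma>: "(\<sigma> x, \<sigma> y) \<in> P' \<longleftrightarrow> (x, y) \<in> P'"
proof -
  have "(\<sigma> x, \<sigma> y) \<in> P'" if "(x, y) \<in> P'" for x y
    using that ab ab_refl ba below_b[of x] above_a[of y] by (auto simp: transpose_def)
  from this[of x y] this[of "\<sigma> x" "\<sigma> y"] show ?thesis by auto
qed

section \<open>One promotion stage in \<open>P\<close> and in \<open>P'\<close>\<close>

lemma \<tau>_not_below:
  assumes u: "u \<in> lin_exts n P" and j: "0 < j" "j < n" and m: "(u ! (j - 1), a) \<notin> P"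
  shows "\<tau> P' j u = \<tau> P j u" "(\<tau> P j u ! j, a) \<notin> P"
proof -
  note len = length_lin_ext[OF u] and notin = lin_ext_adjacent_notin[OF u j]
  \<comment> \<open>The letter \<open>u ! (j - 1)\<close> moves at stage \<open>j\<close>.
    Afterwards index \<open>j\<close> holds the next moving letter: the same one, or a larger one
    that blocked it. The two orders act differently only if \<open>a\<close> and \<open>b\<close>
    are the letters compared.\<close>
  have "u ! (j - 1) \<noteq> a" using m ab_refl by auto
  moreover have "\<not> (u ! (j - 1) = b \<and> u ! j = a)" using notin ab by auto
  ultimately show "\<tau> P' j u = \<tau> P j u" by (auto simp: \<tau>_def)
  show "(\<tau> P j u ! j, a) \<notin> P"
    using m notin P_trans[of "u ! (j - 1)" "u ! j" a] j len by (auto simp: \<tau>_def)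
qed

text \<open>A moving letter weakly above \<open>b\<close> never meets \<open>a\<close>, which
  already precedes it. So both orders act alike on \<open>u\<close>, and the automorphism \<sigma>
  carries this over to \<open>map \<sigma> u\<close>.\<close>

lemma \<tau>_above:
  assumes u: "u \<in> lin_exts n P" and j: "0 < j" "j < n" and m: "(b, u ! (j - 1)) \<in> P"
  shows "\<tau> P' j (map \<sigma> u) = map \<sigma> (\<tau> P j u)" "(b, \<tau> P j u ! j) \<in> P"
proof -
  note len = length_lin_ext[OF u] and notin = lin_ext_adjacent_notin[OF u j]
  have "u ! j \<noteq> a" using P_trans[OF ab(2) m] notin by auto
  moreover have "u ! (j - 1) \<noteq> a" using m ba by auto
  ultimately have "\<tau> P' j u = \<tau> P j u" by (auto simp: \<tau>_def)
  then show "\<tau> P' j (map \<sigma> u) = map \<sigma> (\<tau> P j u)"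
    using \<tau>_map[of j u \<sigma> P'] P'_\<sigma> len j by simp
  show "(b, \<tau> P j u ! j) \<in> P"
    using m notin P_trans[of b "u ! (j - 1)" "u ! j"] j len by (auto simp: \<tau>_def)
qed

text \<open>If the blocking letter is not weakly below \<open>a\<close>, it is weakly above
  \<open>b\<close> by \<open>component\<close>; since comparable neighbours form a covering pair,
  the two letters are \<open>a\<close> and \<open>b\<close>. Exactly then \<open>P\<close> keeps
  them in place while \<open>P'\<close> exchanges them.\<close>

lemma \<tau>_below:
  assumes u: "u \<in> lin_exts n P" and j: "0 < j" "j < n" and m: "(u ! (j - 1), a) \<in> P"
  shows "\<tau> P' j u = \<tau> P j u \<and> (\<tau> P j u ! j, a) \<in> P \<or>
    \<tau> P' j u = map \<sigma> (\<tau> P j u) \<and> (b, \<tau> P j u ! j) \<in> P"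
proof -
  note len = length_lin_ext[OF u] and notin = lin_ext_adjacent_notin[OF u j]
    and neq = lin_ext_adjacent_neq[OF u j] and adj = lin_ext_adjacent_cover[OF u j]
  show ?thesis
  proof (cases "u ! (j - 1) = a \<and> u ! j = b")
    case True
    have dist: "distinct u" using u by (simp add: lin_exts_iff)
    have "\<sigma> (u ! k) = u ! k" if "k < n" "k \<noteq> j" "k \<noteq> j - 1" for k
    proof -
      have "u ! k \<noteq> u ! j" "u ! k \<noteq> u ! (j - 1)"
        using that dist len j by (auto simp: nth_eq_iff_index_eq)
      then show ?thesis using True by auto
    qed
    then have "map \<sigma> u = u[j - 1 := u ! j, j := u ! (j - 1)]"
      using True len j by (intro nth_equalityI) (auto simp: nth_list_update)
    moreover have "\<tau> P j u = u" using True ab by (auto simp: \<tau>_def)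
    moreover have "\<tau> P' j u = u[j - 1 := u ! j, j := u ! (j - 1)]"
      using True ba by (auto simp: \<tau>_def)
    ultimately show ?thesis using True ab_refl by auto
  next
    case False
    have "\<not> (u ! (j - 1) = b \<and> u ! j = a)" using notin ab by auto
    then have eq: "\<tau> P' j u = \<tau> P j u" using False by (auto simp: \<tau>_def)
    have "(u ! j, a) \<in> P" if my: "(u ! (j - 1), u ! j) \<in> P"
    proof (rule ccontr)
      assume "(u ! j, a) \<notin> P"
      then have b_le: "(b, u ! j) \<in> P" using component[OF my] m by blast
      have "a = u ! (j - 1) \<or> a = u ! j"
        using adj[OF ab_range(1) m] P_trans[OF ab(2) b_le] by blast
      then have a: "a = u ! (j - 1)" using b_le ba by auto
      have "b = u ! (j - 1) \<or> b = u ! j"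
        using adj[OF ab_range(2)] b_le a ab by auto
      then show False using a False ab by auto
    qed
    then show ?thesis using eq m notin j len by (auto simp: \<tau>_def)
  qed
qed

text \<open>The letter moving at stage \<open>j\<close> climbs through the poset.  If it starts weakly below \<open>a\<close>, it has
  to reach \<open>a\<close>; from then on \<open>a\<close> stays behind in \<open>P\<close>, whereas \<open>a\<close> and \<open>b\<close> are exchanged in \<open>P'\<close>.\<close>

lemma promotion_P':
  assumes w: "w \<in> lin_exts n P" and i: "i \<in> {1..n}"
  shows "promotion n P' i w =
    (if (w ! (i - 1), a) \<in> P then map \<sigma> (promotion n P i w) else promotion n P i w)"
proof -
  define u where "u j = fold (\<tau> P) [i..<j] w" for j
  define v where "v j = fold (\<tau> P') [i..<j] w" for j
  have u: "u j \<in> lin_exts n P" if "j \<le> n" for j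
    using fold_\<tau>_lin_ext[OF w] that i by (simp add: u_def)
  have Suc: "u (Suc j) = \<tau> P j (u j)" "v (Suc j) = \<tau> P' j (v j)" if "i \<le> j" for j
    using that by (simp_all add: u_def v_def)
  have inv: "if (w ! (i - 1), a) \<in> P
      then v j = u j \<and> (u j ! (j - 1), a) \<in> P \<or> v j = map \<sigma> (u j) \<and> (b, u j ! (j - 1)) \<in> P
      else v j = u j \<and> (u j ! (j - 1), a) \<notin> P" if "i \<le> j" "j \<le> n" for j
    using that
  proof (induction j rule: dec_induct)
    case base
    then show ?case by (auto simp: u_def v_def)
  next
    case (step j)
    have j: "0 < j" "j < n" using step i by auto
    have uj: "u j \<in> lin_exts n P" using u j by simp
    show ?case
      using step.IH j \<tau>_below[OF uj j] \<tau>_above[OF uj j] \<tau>_not_below[OF uj j]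
      unfolding Suc[OF step.hyps(1)] by (auto split: if_splits)
  qed
  have un: "u n \<in> lin_exts n P" using u by simp
  \<comment> \<open>The last letter of a linear extension cannot be weakly below \<open>a\<close>,
    since \<open>b\<close> has to follow it. So a climb that starts weakly below \<open>a\<close>
    ends in the second alternative of the invariant.\<close>
  have "(u n ! (n - 1), a) \<notin> P"
  proof
    assume m: "(u n ! (n - 1), a) \<in> P"
    obtain k where k: "k < n" "u n ! k = b"
      using un ab_range length_lin_ext[OF un] by (metis in_set_conv_nth lin_exts_iff)
    have "(u n ! (n - 1), u n ! k) \<in> P" "u n ! (n - 1) \<noteq> u n ! k"
      using m P_trans[OF m ab(2)] k ba by auto
    then have "n - 1 < k" using lin_ext_less[OF un, of "n - 1" k] k by simp
    then show False using k by simp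
  qed
  then show ?thesis using inv[of n] i by (auto simp: promotion_def u_def v_def split: if_splits)
qed

lemma promotion_P'_\<sigma>:
  assumes w: "w \<in> lin_exts n P" and i: "i \<in> {1..n}"
  shows "promotion n P' i (map \<sigma> w) =
    (if (w ! (i - 1), a) \<in> P then promotion n P i w else map \<sigma> (promotion n P i w))"
proof -
  have "w \<in> lin_exts n P'" using w by (auto simp: lin_exts_iff)
  then show ?thesis
    using promotion_map[of w n P' i \<sigma>] P'_\<sigma> promotion_P'[OF w i] i by (simp add: o_def)
qed

section \<open>The linear extensions of \<open>P'\<close>\<close>

lemma \<sigma>_\<sigma>_word: "map \<sigma> (map \<sigma> w) = w"
  by (simp add: o_def)

lemma \<sigma>_lin_ext_P':
  assumes w: "w \<in> lin_exts n P'"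
  shows "map \<sigma> w \<in> lin_exts n P'"
proof -
  have len: "length w = n" using w by (rule length_lin_ext)
  have "\<sigma> ` {1..n} = {1..n}" using ab_range by (intro transpose_image_eq) auto
  moreover have "i < j" if "i < n" "j < n" "(map \<sigma> w ! i, map \<sigma> w ! j) \<in> P'" "map \<sigma> w ! i \<noteq> map \<sigma> w ! j" for i j
  proof -
    have "(w ! i, w ! j) \<in> P'" using that(3) P'_\<sigma>
      unfolding nth_map[OF that(1)[folded len]] nth_map[OF that(2)[folded len]] by blast
    moreover have "w ! i \<noteq> w ! j" using that len by auto
    ultimately show ?thesis using w that unfolding lin_exts_iff by blast
  qed
  moreover have "distinct (map \<sigma> w)" "set w = {1..n}"
    using w by (simp_all add: lin_exts_iff distinct_map)
  ultimately show ?thesis unfolding lin_exts_iff set_map by blast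
qed

text \<open>If \<open>a\<close> precedes \<open>b\<close>, the dropped relation is respected anyway;
  if \<open>b\<close> precedes \<open>a\<close>, exchanging them leads back to the first case,
  because \<sigma> preserves \<open>P'\<close>.\<close>

lemma lin_exts_P': "lin_exts n P' = lin_exts n P \<union> map \<sigma> ` lin_exts n P"
proof
  have sub: "lin_exts n P \<subseteq> lin_exts n P'" by (auto simp: lin_exts_iff)
  then show "lin_exts n P \<union> map \<sigma> ` lin_exts n P \<subseteq> lin_exts n P'"
    using \<sigma>_lin_ext_P' by blast
  show "lin_exts n P' \<subseteq> lin_exts n P \<union> map \<sigma> ` lin_exts n P"
  proof
    fix w assume w: "w \<in> lin_exts n P'"
    have len: "length w = n" and dist: "distinct w" using w length_lin_ext by (auto simp: lin_exts_iff)
    obtain k l where k: "k < n" "w ! k = a" and l: "l < n" "w ! l = b"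
      using w ab_range len by (metis in_set_conv_nth lin_exts_iff)
    have pos: "i = j" if "i < n" "j < n" "w ! i = w ! j" for i j
      using that dist len nth_eq_iff_index_eq by blast
    have "k \<noteq> l" using k l ab by auto
    then consider "k < l" | "l < k" by linarith
    then show "w \<in> lin_exts n P \<union> map \<sigma> ` lin_exts n P"
    proof cases
      case 1
      have "i < j" if "i < n" "j < n" "(w ! i, w ! j) \<in> P" "w ! i \<noteq> w ! j" for i j
      proof (cases "w ! i = a \<and> w ! j = b")
        case True
        then show ?thesis using 1 pos k l that by metis
      next
        case False
        then show ?thesis using w that unfolding lin_exts_iff by blast
      qed
      then have "w \<in> lin_exts n P" using w unfolding lin_exts_iff by blast
      then show ?thesis ..
    next
      case 2
      let ?w = "map \<sigma> w"
      have w': "?w \<in> lin_exts n P'" using w by (rule \<sigma>_lin_ext_P')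
      have "i < j" if "i < n" "j < n" "(?w ! i, ?w ! j) \<in> P" "?w ! i \<noteq> ?w ! j" for i j
      proof (cases "?w ! i = a \<and> ?w ! j = b")
        case True
        then have "w ! i = b" "w ! j = a" using that len
          by (metis nth_map transpose_apply_first transpose_apply_second transpose_involutory)+
        then show ?thesis using 2 pos k l that by metis
      next
        case False
        then show ?thesis using w' that unfolding lin_exts_iff by blast
      qed
      then have "?w \<in> lin_exts n P" using w' unfolding lin_exts_iff by blast
      then show ?thesis using \<sigma>_\<sigma>_word[of w] by (metis UnI2 image_eqI)
    qed
  qed
qed

lemma \<sigma>_lin_ext_notin:
  assumes w: "w \<in> lin_exts n P"
  shows "map \<sigma> w \<notin> lin_exts n P"
proof
  assume w': "map \<sigma> w \<in> lin_exts n P"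
  have len: "length w = n" using w by (rule length_lin_ext)
  obtain k l where k: "k < n" "w ! k = a" and l: "l < n" "w ! l = b"
    using w ab_range len by (metis in_set_conv_nth lin_exts_iff)
  have "k < l" using lin_ext_less[OF w, of k l] k l ab by simp
  moreover have "l < k" using lin_ext_less[OF w', of l k] k l ab len by simp
  ultimately show False by simp
qed

text \<open>For \<open>c = a\<close>, say, \<open>d\<close> lies above \<open>b\<close> as well,
  whereas in \<open>P'\<close> the element \<open>b\<close> is neither weakly below \<open>a\<close>
  nor weakly above \<open>d\<close>. Hence the upset property for \<open>P'\<close> only concerns
  pairs of \<open>P\<close> that avoid \<open>a\<close> and \<open>b\<close>.\<close>

lemma ordinal_cover_P':
  assumes cd: "ordinal_cover P' c d"
  shows "ordinal_cover P c d" "c \<notin> {a, b}" "d \<notin> {a, b}"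
proof -
  have cd': "c \<noteq> d" "(c, d) \<in> P'" and comp: "\<And>x y. (x, y) \<in> P' \<Longrightarrow>
      (x, c) \<in> P' \<or> (d, x) \<in> P' \<longleftrightarrow> (y, c) \<in> P' \<or> (d, y) \<in> P'"
    using cd unfolding ordinal_cover_def by blast+
  have refl': "(c, c) \<in> P'" "(d, d) \<in> P'" using cd' ab in_range P_refl by auto
  have "c \<noteq> a"
  proof
    assume [simp]: "c = a"
    have bd: "(b, d) \<in> P'" using cd' above_a[of d] by auto
    then have "(b, a) \<in> P' \<or> (d, b) \<in> P'" using comp[OF bd] refl' by auto
    then show False using ba bd P_antisym[of b d] cd' by auto
  qed
  moreover have "c \<noteq> b"
  proof
    assume [simp]: "c = b"
    have ad: "(a, d) \<in> P'" using cd' above_a[of d] by auto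
    then have "(a, b) \<in> P' \<or> (d, a) \<in> P'" using comp[OF ad] refl' by auto
    then show False using ad P_antisym[of a d] cd' ba by auto
  qed
  moreover have "d \<noteq> a"
  proof
    assume [simp]: "d = a"
    have cb: "(c, b) \<in> P'" using cd' below_b[of c] by auto
    then have "(b, c) \<in> P' \<or> (a, b) \<in> P'" using comp[OF cb] refl' by auto
    then show False using cb P_antisym[of b c] cd' ba by auto
  qed
  moreover have "d \<noteq> b"
  proof
    assume [simp]: "d = b"
    have ca: "(c, a) \<in> P'" using cd' below_b[of c] by auto
    then have "(a, c) \<in> P' \<or> (b, a) \<in> P'" using comp[OF ca] refl' by auto
    then show False using ca P_antisym[of a c] cd' ba by auto
  qed
  ultimately show ncd: "c \<notin> {a, b}" "d \<notin> {a, b}" by auto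
  have "(x, c) \<in> P \<or> (d, x) \<in> P \<longleftrightarrow> (y, c) \<in> P \<or> (d, y) \<in> P" if "(x, y) \<in> P" for x y
  proof (cases "x = a \<and> y = b")
    case True
    then show ?thesis using above_a[of c] below_b[of d] ncd by auto
  next
    case False
    then show ?thesis using comp[of x y] that ncd by auto
  qed
  then show "ordinal_cover P c d" using cd' unfolding ordinal_cover_def by blast
qed

text \<open>Nothing lies strictly between \<open>a\<close> and \<open>b\<close>, so transitivity
  never has to produce the dropped pair.\<close>

lemma partial_order_P': "partial_order_on {1..n} P'"
proof -
  have "(x, z) \<in> P'" if "(x, y) \<in> P'" "(y, z) \<in> P'" for x y z
    using that P_trans[of x y z] below_b[of y] above_a[of y] P_antisym[of a y] P_antisym[of y b] by auto
  then have "trans P'" unfolding trans_def by blast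
  moreover have "refl_on {1..n} P'" using P_refl in_range ab unfolding refl_on_def by auto
  moreover have "antisym P'" using P_antisym unfolding antisym_def by blast
  moreover have "P' \<subseteq> {1..n} \<times> {1..n}" using in_range by auto
  ultimately show ?thesis unfolding order_on_defs by blast
qed

end

section \<open>Promotion matrices\<close>

lemma proots_prod_linear_factors:
  fixes A :: "'a :: idom multiset"
  shows "proots (\<Prod>x\<in>#A. [:- x, 1:]) = A"
proof (induction A)
  case (add x A)
  have "(\<Prod>x\<in>#A. [:- x, 1:]) \<noteq> 0" by (auto simp: prod_mset_zero_iff)
  then show ?case using add by (simp add: proots_mult del: mult_pCons_left)
qed simp

lemma eigenvalues_eqI:
  "char_poly M = (\<Prod>f\<in>#E. [:- f, 1:]) \<Longrightarrow> eigenvalues M = E"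
  by (simp add: eigenvalues_def proots_prod_linear_factors)

section \<open>Combinations of constant matrices with polynomial weights\<close>

interpretation const: comm_ring_hom const
  by unfold_locales (simp_all add: const_def single_add mult_single)

text \<open>The weights are arbitrary because \<open>var\<close> gives the promotion matrix itself,
  while the blocks for \<open>P'\<close> need weights that are zero at some letters or swapped by
  \<sigma>.\<close>

definition weighted_mat :: "nat \<Rightarrow> nat \<Rightarrow> (nat \<Rightarrow> cpoly) \<Rightarrow> (nat \<Rightarrow> complex mat) \<Rightarrow> cpoly mat" where
  "weighted_mat n N l G = mat N N (\<lambda>(r, c). \<Sum>k=1..n. l k * const (G k $$ (r, c)))"

lemma weighted_mat_carrier [simp]: "weighted_mat n N l G \<in> carrier_mat N N"
  by (simp add: weighted_mat_def)

lemma weighted_mat_mult_left: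
  assumes S: "S \<in> carrier_mat N N" and G: "\<And>k. G k \<in> carrier_mat N N"
  shows "map_mat const S * weighted_mat n N l G = weighted_mat n N l (\<lambda>k. S * G k)"
proof (rule eq_matI)
  fix r c assume "r < dim_row (weighted_mat n N l (\<lambda>k. S * G k))" "c < dim_col (weighted_mat n N l (\<lambda>k. S * G k))"
  then have rc: "r < N" "c < N" by (auto simp: weighted_mat_def)
  have "(map_mat const S * weighted_mat n N l G) $$ (r, c) =
      (\<Sum>p = 0..<N. \<Sum>k=1..n. l k * (const (S $$ (r, p)) * const (G k $$ (p, c))))"
    using S rc by (simp add: weighted_mat_def scalar_prod_def sum_distrib_left mult.left_commute)
  also have "\<dots> = (\<Sum>k=1..n. l k * (\<Sum>p = 0..<N. const (S $$ (r, p)) * const (G k $$ (p, c))))"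
    by (subst sum.swap) (simp add: sum_distrib_left)
  also have "\<dots> = weighted_mat n N l (\<lambda>k. S * G k) $$ (r, c)"
    using S rc G[THEN carrier_matD(1)] G[THEN carrier_matD(2)]
    by (simp add: weighted_mat_def scalar_prod_def const.hom_sum const.hom_mult)
  finally show "(map_mat const S * weighted_mat n N l G) $$ (r, c) = weighted_mat n N l (\<lambda>k. S * G k) $$ (r, c)" .
qed (use S in \<open>auto simp: weighted_mat_def\<close>)

lemma weighted_mat_mult_right:
  assumes S: "S \<in> carrier_mat N N" and G: "\<And>k. G k \<in> carrier_mat N N"
  shows "weighted_mat n N l G * map_mat const S = weighted_mat n N l (\<lambda>k. G k * S)"
proof (rule eq_matI)
  fix r c assume "r < dim_row (weighted_mat n N l (\<lambda>k. G k * S))" "c < dim_col (weighted_mat n N l (\<lambda>k. G k * S))"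
  then have rc: "r < N" "c < N" by (auto simp: weighted_mat_def)
  have "(weighted_mat n N l G * map_mat const S) $$ (r, c) =
      (\<Sum>p = 0..<N. \<Sum>k=1..n. l k * (const (G k $$ (r, p)) * const (S $$ (p, c))))"
    using S rc by (simp add: weighted_mat_def scalar_prod_def sum_distrib_right mult.assoc)
  also have "\<dots> = (\<Sum>k=1..n. l k * (\<Sum>p = 0..<N. const (G k $$ (r, p)) * const (S $$ (p, c))))"
    by (subst sum.swap) (simp add: sum_distrib_left)
  also have "\<dots> = weighted_mat n N l (\<lambda>k. G k * S) $$ (r, c)"
    using S rc G[THEN carrier_matD(1)] G[THEN carrier_matD(2)]
    by (simp add: weighted_mat_def scalar_prod_def const.hom_sum const.hom_mult)
  finally show "(weighted_mat n N l G * map_mat const S) $$ (r, c) = weighted_mat n N l (\<lambda>k. G k * S) $$ (r, c)" .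
qed (use S in \<open>auto simp: weighted_mat_def\<close>)

text \<open>A constant matrix acts on each \<open>G k\<close> separately, so the same
  \<open>S\<close> and \<open>S'\<close> conjugate the combinations for all weights
  \<open>l\<close>.\<close>

lemma similar_weighted_mat:
  assumes S: "S \<in> carrier_mat N N" "S' \<in> carrier_mat N N" and inv: "S * S' = 1\<^sub>m N" "S' * S = 1\<^sub>m N"
    and G: "\<And>k. G k \<in> carrier_mat N N"
  shows "similar_mat_wit (weighted_mat n N l (\<lambda>k. S * G k * S')) (weighted_mat n N l G)
    (map_mat const S) (map_mat const S')"
proof (rule similar_mat_witI[where n = N])
  show "map_mat const S * map_mat const S' = 1\<^sub>m N" "map_mat const S' * map_mat const S = 1\<^sub>m N"
    using const.mat_hom_mult[OF S] const.mat_hom_mult[OF S(2,1)] inv const.mat_hom_one by simp_all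
  have "\<And>k. S * G k \<in> carrier_mat N N" using S G by simp
  then show "weighted_mat n N l (\<lambda>k. S * G k * S') =
      map_mat const S * weighted_mat n N l G * map_mat const S'"
    using S G by (simp add: weighted_mat_mult_left weighted_mat_mult_right)
qed (use S in auto)

lemma length_lin_ext_list: "length (lin_ext_list n P) = card (lin_exts n P)"
  by (metis distinct_card distinct_lin_ext_list set_lin_ext_list)

lemma G_mat_carrier: "G_mat n P k \<in> carrier_mat (card (lin_exts n P)) (card (lin_exts n P))"
  by (simp add: G_mat_def Let_def length_lin_ext_list)

lemma promotion_mat_weighted:
  "promotion_mat n P = weighted_mat n (card (lin_exts n P)) var (G_mat n P)"
proof (rule eq_matI)
  fix r c assume "r < dim_row (weighted_mat n (card (lin_exts n P)) var (G_mat n P))"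
    "c < dim_col (weighted_mat n (card (lin_exts n P)) var (G_mat n P))"
  then have rc: "r < card (lin_exts n P)" "c < card (lin_exts n P)" by (auto simp: weighted_mat_def)
  then show "promotion_mat n P $$ (r, c) = weighted_mat n (card (lin_exts n P)) var (G_mat n P) $$ (r, c)"
    using promotion_mat_eq_sum[of r n P c] by (simp add: length_lin_ext_list weighted_mat_def)
qed (simp_all add: promotion_mat_def Let_def weighted_mat_def length_lin_ext_list)

lemma position_lin_ext:
  assumes w: "w \<in> lin_exts n P" and j: "j \<in> {1..n}"
  shows "position n w (w ! (j - 1)) = j"
  unfolding position_def
proof (rule the_equality)
  fix i assume i: "i \<in> {1..n} \<and> w ! (i - 1) = w ! (j - 1)"
  have "distinct w" "length w = n" using w length_lin_ext by (auto simp: lin_exts_iff)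
  then have "i - 1 = j - 1" using i j by (subst nth_eq_iff_index_eq[symmetric, of w]) auto
  then show "i = j" using i j by auto
qed (use j in simp)

lemma bij_betw_lin_ext:
  assumes w: "w \<in> lin_exts n P"
  shows "bij_betw (\<lambda>j. w ! (j - 1)) {1..n} {1..n}"
proof -
  have "bij_betw (\<lambda>j. j - 1) {1..n} {..<n}"
    by (rule bij_betwI[where g = Suc]) auto
  moreover have "bij_betw ((!) w) {..<n} {1..n}"
    using w length_lin_ext[OF w] by (intro bij_betw_nth) (auto simp: lin_exts_iff)
  ultimately show ?thesis by (auto dest: bij_betw_trans simp: o_def)
qed

lemma weighted_G_mat_index:
  assumes "r < card (lin_exts n P)" "c < card (lin_exts n P)"
  defines "w \<equiv> lin_ext_list n P ! r" and "w' \<equiv> lin_ext_list n P ! c"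
  shows "weighted_mat n (card (lin_exts n P)) l (G_mat n P) $$ (r, c) =
    (\<Sum>i=1..n. if promotion n P i w = w' then l (w ! (i - 1)) else 0)"
proof -
  have w: "w \<in> lin_exts n P"
    unfolding w_def using assms(1) by (metis length_lin_ext_list nth_mem set_lin_ext_list)
  have "weighted_mat n (card (lin_exts n P)) l (G_mat n P) $$ (r, c) =
      (\<Sum>k=1..n. l k * const (G_mat n P k $$ (r, c)))"
    using assms by (simp add: weighted_mat_def)
  also have "\<dots> = (\<Sum>i=1..n. l (w ! (i - 1)) * const (G_mat n P (w ! (i - 1)) $$ (r, c)))"
    by (rule sum.reindex_bij_betw[OF bij_betw_lin_ext[OF w], symmetric])
  also have "\<dots> = (\<Sum>i=1..n. if promotion n P i w = w' then l (w ! (i - 1)) else 0)"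
    using assms position_lin_ext[OF w]
    by (intro sum.cong refl) (auto simp: G_mat_def Let_def length_lin_ext_list)
  finally show ?thesis .
qed

definition lform :: "nat \<Rightarrow> (nat \<Rightarrow> complex) \<Rightarrow> cpoly" where
  "lform n c = (\<Sum>k=1..n. const (c k) * var k)"

lemma coef_lform: "k \<in> {1..n} \<Longrightarrow> coef (lform n c) k = c k"
  unfolding lform_def by (rule coef_linear_form)

lemma char_poly_promotion_mat:
  fixes S S' :: "complex mat" and n :: nat and P :: "nat rel"
  defines "N \<equiv> card (lin_exts n P)"
  assumes S: "S \<in> carrier_mat N N" "S' \<in> carrier_mat N N" and inv: "S * S' = 1\<^sub>m N" "S' * S = 1\<^sub>m N"
    and ut: "\<And>k. k \<in> {1..n} \<Longrightarrow> upper_triangular (S * G_mat n P k * S')"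
  shows "char_poly (promotion_mat n P) =
    (\<Prod>s = 0..<N. [:- lform n (\<lambda>k. (S * G_mat n P k * S') $$ (s, s)), 1:])"
proof -
  let ?U = "weighted_mat n N var (\<lambda>k. S * G_mat n P k * S')"
  have G: "G_mat n P k \<in> carrier_mat N N" for k unfolding N_def by (rule G_mat_carrier)
  have "similar_mat ?U (promotion_mat n P)"
    unfolding promotion_mat_weighted N_def[symmetric] similar_mat_def
    using similar_weighted_mat[where G = "G_mat n P", OF S inv G] by blast
  then have "char_poly (promotion_mat n P) = char_poly ?U" using char_poly_similar by metis
  also have "\<dots> = (\<Prod>s = 0..<N. [:- (?U $$ (s, s)), 1:])"
  proof (rule char_poly_rank_triangular[where \<rho> = id])
    fix i j assume ij: "i < N" "j < N" "i \<noteq> j" "\<not> id i < id j"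
    have "(S * G_mat n P k * S') $$ (i, j) = 0" if "k \<in> {1..n}" for k
      using ut[OF that] ij S unfolding upper_triangular_def by auto
    then show "?U $$ (i, j) = 0" using ij by (simp add: weighted_mat_def)
  qed simp
  also have "\<dots> = (\<Prod>s = 0..<N. [:- lform n (\<lambda>k. (S * G_mat n P k * S') $$ (s, s)), 1:])"
    by (intro prod.cong refl) (simp add: weighted_mat_def lform_def mult.commute)
  finally show ?thesis .
qed

section \<open>The block form of the matrix of \<open>P'\<close>\<close>

context ordinal_cover_poset
begin

text \<open>The linear extensions of \<open>P\<close> are listed first, then their images under
  \<sigma> in the same order. The off-diagonal blocks collect the starting letters \<open>k\<close>
  weakly below \<open>a\<close>; in the second block row the letter at the same position is
  \<open>\<sigma> k\<close>, whence the weights \<open>var (\<sigma> k)\<close>.\<close>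

lemma promotion_mat_P'_block:
  defines "N \<equiv> card (lin_exts n P)"
  defines "W \<equiv> \<lambda>l. weighted_mat n N l (G_mat n P)"
  shows "char_poly (promotion_mat n P') = char_poly (four_block_mat
    (W (\<lambda>k. if (k, a) \<in> P then 0 else var k)) (W (\<lambda>k. if (k, a) \<in> P then var k else 0))
    (W (\<lambda>k. if (k, a) \<in> P then var (\<sigma> k) else 0)) (W (\<lambda>k. if (k, a) \<in> P then 0 else var (\<sigma> k))))"
proof -
  define L where "L = lin_ext_list n P"
  define K where "K = L @ map (map \<sigma>) L"
  define F where "F w w' = (\<Sum>i=1..n. if promotion n P' i w = w' then var (w ! (i - 1)) else 0)" for w w'
  have lenL: "length L = N" by (simp add: L_def N_def length_lin_ext_list)
  have setL: "set L = lin_exts n P" by (simp add: L_def set_lin_ext_list)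
  have inj: "map \<sigma> v = map \<sigma> w \<longleftrightarrow> v = w" for v w
    using \<sigma>_\<sigma>_word by metis
  have "distinct K"
    using distinct_lin_ext_list[of n P] \<sigma>_lin_ext_notin
    by (auto simp: K_def distinct_map inj_on_def inj setL L_def[symmetric])
  moreover have "set K = lin_exts n P'" by (simp add: K_def setL lin_exts_P')
  ultimately have mset: "mset (lin_ext_list n P') = mset K"
    using set_eq_iff_mset_eq_distinct[OF distinct_lin_ext_list[of n P'] \<open>distinct K\<close>]
    by (simp add: set_lin_ext_list)
  have "promotion_mat n P' = mat (length (lin_ext_list n P')) (length (lin_ext_list n P'))
      (\<lambda>(i, j). F (lin_ext_list n P' ! i) (lin_ext_list n P' ! j))"
    by (rule eq_matI) (simp_all add: promotion_mat_def Let_def F_def flip: sum.inter_filter)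
  then have "char_poly (promotion_mat n P') =
      char_poly (mat (length K) (length K) (\<lambda>(i, j). F (K ! i) (K ! j)))"
    using char_poly_mset_cong[OF mset, of F] by simp
  also have "mat (length K) (length K) (\<lambda>(i, j). F (K ! i) (K ! j)) = four_block_mat
    (W (\<lambda>k. if (k, a) \<in> P then 0 else var k)) (W (\<lambda>k. if (k, a) \<in> P then var k else 0))
    (W (\<lambda>k. if (k, a) \<in> P then var (\<sigma> k) else 0)) (W (\<lambda>k. if (k, a) \<in> P then 0 else var (\<sigma> k)))"
    (is "_ = ?B")
  proof (rule eq_matI)
    have dimW: "dim_row (W l) = N" "dim_col (W l) = N" for l
      by (simp_all add: W_def weighted_mat_def)
    show "dim_row (mat (length K) (length K) (\<lambda>(i, j). F (K ! i) (K ! j))) = dim_row ?B"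
      "dim_col (mat (length K) (length K) (\<lambda>(i, j). F (K ! i) (K ! j))) = dim_col ?B"
      by (simp_all add: K_def lenL dimW)
    have F_eq: "F (L ! r) (L ! c) = W (\<lambda>k. if (k, a) \<in> P then 0 else var k) $$ (r, c)"
        "F (L ! r) (map \<sigma> (L ! c)) = W (\<lambda>k. if (k, a) \<in> P then var k else 0) $$ (r, c)"
        "F (map \<sigma> (L ! r)) (L ! c) = W (\<lambda>k. if (k, a) \<in> P then var (\<sigma> k) else 0) $$ (r, c)"
        "F (map \<sigma> (L ! r)) (map \<sigma> (L ! c)) = W (\<lambda>k. if (k, a) \<in> P then 0 else var (\<sigma> k)) $$ (r, c)"
      if rc: "r < N" "c < N" for r c
    proof -
      have w: "L ! r \<in> lin_exts n P" and w': "L ! c \<in> lin_exts n P"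
        using rc lenL setL nth_mem by metis+
      have W_eq: "W l $$ (r, c) =
          (\<Sum>i=1..n. if promotion n P i (L ! r) = L ! c then l (L ! r ! (i - 1)) else 0)" for l
        using weighted_G_mat_index[of r n P c l] rc unfolding W_def N_def L_def by blast
      have p: "promotion n P i (L ! r) \<in> lin_exts n P" if "i \<in> {1..n}" for i
        using promotion_lin_ext[OF w] that by simp
      have neq: "map \<sigma> v \<noteq> v'" "v' \<noteq> map \<sigma> v" if "v \<in> lin_exts n P" "v' \<in> lin_exts n P" for v v'
        using \<sigma>_lin_ext_notin that by blast+
      have letter: "map \<sigma> (L ! r) ! (i - Suc 0) = \<sigma> (L ! r ! (i - Suc 0))" if "i \<in> {1..n}" for i
        using that length_lin_ext[OF w] by auto
      \<comment> \<open>By \<open>neq\<close> a linear extension of \<open>P\<close> never equals an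
        image of one under \<sigma>, so only one branch of the promotion rules can contribute to
        each block.\<close>
      note eqs = promotion_P'[OF w] promotion_P'_\<sigma>[OF w] letter inj neq[OF p w'] neq[OF w' p] neq[OF w' w']
      show "F (L ! r) (L ! c) = W (\<lambda>k. if (k, a) \<in> P then 0 else var k) $$ (r, c)"
        "F (L ! r) (map \<sigma> (L ! c)) = W (\<lambda>k. if (k, a) \<in> P then var k else 0) $$ (r, c)"
        "F (map \<sigma> (L ! r)) (L ! c) = W (\<lambda>k. if (k, a) \<in> P then var (\<sigma> k) else 0) $$ (r, c)"
        "F (map \<sigma> (L ! r)) (map \<sigma> (L ! c)) = W (\<lambda>k. if (k, a) \<in> P then 0 else var (\<sigma> k)) $$ (r, c)"
        unfolding W_eq F_def by (intro sum.cong refl; simp add: eqs del: nth_map cong: if_cong)+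
    qed
    fix i j assume "i < dim_row ?B" "j < dim_col ?B"
    then have "i < N + N" "j < N + N" by (simp_all add: dimW)
    moreover have "length K = N + N" by (simp add: K_def lenL)
    moreover have "K ! i = (if i < N then L ! i else map \<sigma> (L ! (i - N)))" if "i < N + N" for i
      using that by (auto simp: K_def nth_append lenL)
    ultimately show "mat (length K) (length K) (\<lambda>(i, j). F (K ! i) (K ! j)) $$ (i, j) = ?B $$ (i, j)"
      by (auto simp: dimW F_eq[symmetric])
  qed
  finally show ?thesis .
qed

text \<open>The second branch applies the swap of \<open>a\<close> and \<open>b\<close>; under the upset property \<open>c a = 0\<close> there.\<close>

definition second_coef :: "(nat \<Rightarrow> complex) \<Rightarrow> nat \<Rightarrow> complex" where
  "second_coef c k = (if c a = c b
     then if (k, b) \<notin> P then c k else if k = a \<or> k = b then 0 else - c k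
     else c (\<sigma> k))"

text \<open>Serves for sums in which \<sigma> exchanges \<open>var a\<close> and
  \<open>var b\<close>: the terms at these two indices need to agree only in total.\<close>

lemma sum_two_points:
  fixes g :: "nat \<Rightarrow> cpoly"
  assumes "\<And>k. k \<in> {1..n} \<Longrightarrow> k \<noteq> a \<Longrightarrow> k \<noteq> b \<Longrightarrow> g k = h k" and "g a + g b = h a + h b"
  shows "(\<Sum>k=1..n. g k) = (\<Sum>k=1..n. h k)"
proof -
  have split: "(\<Sum>k=1..n. f k) = (f a + f b) + (\<Sum>k\<in>{1..n} - {a, b}. f k)" for f :: "nat \<Rightarrow> cpoly"
    using ab_range ab sum.subset_diff[of "{a, b}" "{1..n}" f] by (simp add: add.commute)
  show ?thesis unfolding split[of g] split[of h] using assms by simp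
qed

text \<open>Under the hypothesis, \<open>c a\<close> and \<open>c b\<close> are both zero or both
  nonzero exactly when they are equal.\<close>

lemma second_eigenvalue_lform:
  assumes c: "c a = c b \<or> c a = 0"
  shows "second_eigenvalue n P a b (lform n c) = lform n (second_coef c)"
proof (cases "c a = c b")
  case True
  have "second_eigenvalue n P a b (lform n c) =
     (\<Sum>k | k \<in> {1..n} \<and> (k, b) \<notin> P. const (c k) * var k)
       - (\<Sum>k | k \<in> {1..n} \<and> (k, a) \<in> P \<and> k \<noteq> a. const (c k) * var k)"
    using True ab_range by (simp add: second_eigenvalue_def coef_lform)
  also have "\<dots> = (\<Sum>k=1..n. (if (k, b) \<notin> P then const (c k) * var k else 0)
      - (if (k, a) \<in> P \<and> k \<noteq> a then const (c k) * var k else 0))"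
    by (simp add: sum_subtractf flip: sum.inter_filter)
  also have "\<dots> = lform n (second_coef c)"
    unfolding lform_def
  proof (intro sum.cong refl)
    fix k
    show "(if (k, b) \<notin> P then const (c k) * var k else 0)
      - (if (k, a) \<in> P \<and> k \<noteq> a then const (c k) * var k else 0) = const (second_coef c k) * var k"
    proof (cases "k = a \<or> k = b")
      case True
      then show ?thesis using \<open>c a = c b\<close> ab ab_refl ba by (auto simp: second_coef_def)
    next
      case False
      then show ?thesis using \<open>c a = c b\<close> below_b[of k]
        by (auto simp: second_coef_def const.hom_uminus)
    qed
  qed
  finally show ?thesis .
next
  case False
  then have "c a = 0" "c b \<noteq> 0" using c by auto
  then have "second_eigenvalue n P a b (lform n c) = lform n c - const (c b) * var b + const (c b) * var a"
    using ab_range by (simp add: second_eigenvalue_def coef_lform)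
  \<comment> \<open>Both correction terms are attached to the summand at \<open>b\<close>, so that
    the comparison with the swapped coefficients is confined to \<open>a\<close> and
    \<open>b\<close>.\<close>
  also have "\<dots> = (\<Sum>k=1..n. const (c k) * var k + (if k = b then const (c b) * (var a - var b) else 0))"
    unfolding lform_def sum.distrib using ab_range by (simp add: algebra_simps)
  also have "\<dots> = lform n (second_coef c)"
    unfolding lform_def using ab False \<open>c a = 0\<close>
    by (intro sum_two_points) (auto simp: second_coef_def algebra_simps)
  finally show ?thesis .
qed

text \<open>The entry \<open>D - B\<close> of the matrix of size two belonging to \<open>c\<close>:
  its eigenvalue besides that of \<open>(1, 1)\<close>.\<close>

lemma lform_second_coef_eq:
  assumes c: "c a = c b"
  shows "(\<Sum>k=1..n. (if (k, a) \<in> P then 0 else var (\<sigma> k)) * const (c k))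
    - (\<Sum>k=1..n. (if (k, a) \<in> P then var k else 0) * const (c k)) = lform n (second_coef c)"
  unfolding lform_def sum_subtractf[symmetric]
proof (rule sum_two_points)
  fix k assume k: "k \<noteq> a" "k \<noteq> b"
  show "(if (k, a) \<in> P then 0 else var (\<sigma> k)) * const (c k) - (if (k, a) \<in> P then var k else 0) * const (c k)
      = const (second_coef c k) * var k"
    using k below_b[of k] c by (simp add: second_coef_def const.hom_uminus mult.commute)
qed (use ab ab_refl ba c in \<open>simp add: second_coef_def mult.commute\<close>)

text \<open>Here both off-diagonal entries vanish, and the second eigenvalue is the entry
  \<open>D\<close> itself.\<close>

lemma lform_second_coef_neq:
  assumes c: "c a \<noteq> c b" "\<forall>k. (k, a) \<in> P \<longrightarrow> c k = 0"
  shows "(\<Sum>k=1..n. (if (k, a) \<in> P then 0 else var (\<sigma> k)) * const (c k)) = lform n (second_coef c)"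
  unfolding lform_def
proof (rule sum_two_points)
  fix k assume k: "k \<noteq> a" "k \<noteq> b"
  show "(if (k, a) \<in> P then 0 else var (\<sigma> k)) * const (c k) = const (second_coef c k) * var k"
    using k c by (simp add: second_coef_def mult.commute)
qed (use ab ab_refl ba c in \<open>simp add: second_coef_def mult.commute\<close>)

text \<open>The sum \<open>C + D\<close> of the second row. The first row has the same sum, which
  makes \<open>(1, 1)\<close> an eigenvector.\<close>

lemma lform_\<sigma>:
  assumes c: "c a = c b"
  shows "(\<Sum>k=1..n. (if (k, a) \<in> P then var (\<sigma> k) else 0) * const (c k))
    + (\<Sum>k=1..n. (if (k, a) \<in> P then 0 else var (\<sigma> k)) * const (c k)) = lform n c"
  unfolding lform_def sum.distrib[symmetric]
proof (rule sum_two_points)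
  fix k assume k: "k \<noteq> a" "k \<noteq> b"
  show "(if (k, a) \<in> P then var (\<sigma> k) else 0) * const (c k) + (if (k, a) \<in> P then 0 else var (\<sigma> k)) * const (c k)
      = const (c k) * var k"
    using k by (simp add: mult.commute)
qed (use ab_refl ba c in \<open>simp add: algebra_simps\<close>)

lemma char_poly_promotion_mat_P':
  fixes S S' :: "complex mat"
  defines "N \<equiv> card (lin_exts n P)"
  defines "c \<equiv> \<lambda>s k. (S * G_mat n P k * S') $$ (s, s)"
  assumes S: "S \<in> carrier_mat N N" "S' \<in> carrier_mat N N" and inv: "S * S' = 1\<^sub>m N" "S' * S = 1\<^sub>m N"
    and ut: "\<And>k. k \<in> {1..n} \<Longrightarrow> upper_triangular (S * G_mat n P k * S')"
    and c: "\<And>s. s < N \<Longrightarrow> c s a = c s b \<or> (\<forall>k. (k, a) \<in> P \<longrightarrow> c s k = 0)"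
  shows "char_poly (promotion_mat n P') =
    (\<Prod>s = 0..<N. [:- lform n (c s), 1:] * [:- lform n (second_coef (c s)), 1:])"
proof -
  define W where "W = (\<lambda>l. weighted_mat n N l (G_mat n P))"
  define U where "U = (\<lambda>l. weighted_mat n N l (\<lambda>k. S * G_mat n P k * S'))"
  have G: "G_mat n P k \<in> carrier_mat N N" for k unfolding N_def by (rule G_mat_carrier)
  have carr: "W l \<in> carrier_mat N N" "U l \<in> carrier_mat N N" for l by (simp_all add: W_def U_def)
  have sim: "similar_mat_wit (U l) (W l) (map_mat const S) (map_mat const S')" for l
    unfolding U_def W_def by (rule similar_weighted_mat[OF S inv G])
  have U_eq: "U l = map_mat const S * W l * map_mat const S'" for l
    using similar_mat_witD2(3)[OF carr(2) sim] .
  have "similar_mat (four_block_mat (U lA) (U lB) (U lC) (U lD))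
      (four_block_mat (W lA) (W lB) (W lC) (W lD))" for lA lB lC lD
    unfolding similar_mat_def
    using similar_mat_wit_four_block[OF sim sim U_eq U_eq carr(2) carr(2) carr(1) carr(1)] by blast
  note UW = char_poly_similar[OF this]
  have block: "char_poly (promotion_mat n P') = char_poly (four_block_mat
      (U (\<lambda>k. if (k, a) \<in> P then 0 else var k)) (U (\<lambda>k. if (k, a) \<in> P then var k else 0))
      (U (\<lambda>k. if (k, a) \<in> P then var (\<sigma> k) else 0)) (U (\<lambda>k. if (k, a) \<in> P then 0 else var (\<sigma> k))))"
    unfolding UW unfolding W_def N_def by (rule promotion_mat_P'_block)
  have U_lower: "U l $$ (i, j) = 0" if "j < i" "i < N" for l i j
  proof -
    have "(S * G_mat n P k * S') $$ (i, j) = 0" if "k \<in> {1..n}" for k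
      using ut[OF that] \<open>j < i\<close> \<open>i < N\<close> S unfolding upper_triangular_def by auto
    then show ?thesis using that by (simp add: U_def weighted_mat_def)
  qed
  have U_diag: "U l $$ (s, s) = (\<Sum>k=1..n. l k * const (c s k))" if "s < N" for l s
    using that by (simp add: U_def weighted_mat_def c_def)
  \<comment> \<open>The value 1 selects the eigenvector \<open>(1, 1)\<close> for equal
    coefficients; otherwise the lower left entry is zero and the value 0 selects
    \<open>(1, 0)\<close>. Below, \<open>?A\<close> and \<open>?D\<close> give the two eigenvalues,
    and \<open>?C\<close> with \<open>?A\<close> gives the eigenvector equation.\<close>
  define e :: "nat \<Rightarrow> cpoly" where "e s = (if c s a = c s b then 1 else 0)" for s
  have diag: "U (\<lambda>k. if (k, a) \<in> P then 0 else var k) $$ (s, s) +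
        U (\<lambda>k. if (k, a) \<in> P then var k else 0) $$ (s, s) * e s = lform n (c s)" (is ?A)
    "U (\<lambda>k. if (k, a) \<in> P then 0 else var (\<sigma> k)) $$ (s, s) -
        e s * U (\<lambda>k. if (k, a) \<in> P then var k else 0) $$ (s, s) = lform n (second_coef (c s))" (is ?D)
    "U (\<lambda>k. if (k, a) \<in> P then var (\<sigma> k) else 0) $$ (s, s) +
        U (\<lambda>k. if (k, a) \<in> P then 0 else var (\<sigma> k)) $$ (s, s) * e s = e s * lform n (c s)" (is ?C)
    if s: "s < N" for s
  proof -
    show ?A
    proof (cases "c s a = c s b")
      case True
      then show ?thesis unfolding U_diag[OF s] lform_def e_def
        by (simp flip: sum.distrib) (intro sum.cong refl; simp add: mult.commute)
    next
      case False
      then show ?thesis using c[OF s] unfolding U_diag[OF s] lform_def e_def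
        by (simp, intro sum.cong refl) (auto simp: mult.commute)
    qed
    show ?D
    proof (cases "c s a = c s b")
      case True
      then show ?thesis using lform_second_coef_eq[OF True] unfolding U_diag[OF s] e_def by simp
    next
      case False
      then show ?thesis using lform_second_coef_neq[OF False] c[OF s] unfolding U_diag[OF s] e_def by simp
    qed
    show ?C
    proof (cases "c s a = c s b")
      case True
      then show ?thesis using lform_\<sigma>[OF True] unfolding U_diag[OF s] e_def by simp
    next
      case False
      then show ?thesis using c[OF s] unfolding U_diag[OF s] e_def by (simp add: sum.neutral)
    qed
  qed
  show ?thesis
    unfolding block
    by (subst char_poly_block_of_triangular[where e = e, OF carr(2) carr(2) carr(2) carr(2)])
      (auto simp: U_lower diag intro!: prod.cong)
qed

end

section \<open>The upset property in terms of coefficient functions\<close>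

definition upset_coefs :: "nat rel \<Rightarrow> (nat \<Rightarrow> complex) \<Rightarrow> bool" where
  "upset_coefs P c \<longleftrightarrow> (\<forall>p q. ordinal_cover P p q \<longrightarrow>
     (c p \<noteq> 0 \<longrightarrow> c p = c q) \<and>
     (c q \<noteq> 0 \<and> c p = 0 \<longrightarrow> (\<forall>k. (k, p) \<in> P \<and> k \<noteq> p \<longrightarrow> c k = 0)))"

text \<open>The factorization settles the splitting and the linearity of the eigenvalues. What
  remains are conditions on coefficients, read off at elements of \<open>{1..n}\<close>, where
  \<open>coef_lform\<close> applies.\<close>

lemma upset_property_lform:
  assumes po: "partial_order_on {1..n} P"
    and E: "char_poly (promotion_mat n P) = (\<Prod>c\<in>#E. [:- lform n c, 1:])"
  shows "upset_property n P \<longleftrightarrow> (\<forall>c\<in>#E. upset_coefs P c)"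
proof -
  have ev: "eigenvalues (promotion_mat n P) = image_mset (lform n) E"
    by (rule eigenvalues_eqI) (simp add: E image_mset.compositionality o_def)
  have in_range: "x \<in> {1..n} \<and> y \<in> {1..n}" if "(x, y) \<in> P" for x y
    using po that unfolding order_on_defs refl_on_def by blast
  have P_refl: "(x, x) \<in> P" if "x \<in> {1..n}" for x
    using po that unfolding order_on_defs refl_on_def by blast
  have "Field P = {1..n}"
    using in_range by (fastforce simp: Field_def intro: P_refl)
  then have R: "(p, q) \<in> R_pairs P \<longleftrightarrow> ordinal_cover P p q" for p q
    using po by (intro R_pairs_iff) simp
  have "(\<forall>(p, q)\<in>R_pairs P.
        (coef (lform n c) p \<noteq> 0 \<longrightarrow> coef (lform n c) q \<noteq> 0 \<and> coef (lform n c) p = coef (lform n c) q) \<and>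
        (coef (lform n c) q \<noteq> 0 \<and> coef (lform n c) p = 0 \<longrightarrow>
          (\<forall>k. (k, p) \<in> P \<and> k \<noteq> p \<longrightarrow> coef (lform n c) k = 0))) \<longleftrightarrow> upset_coefs P c" (is "?l \<longleftrightarrow> _") for c
  proof -
    have "?l \<longleftrightarrow> (\<forall>p q. ordinal_cover P p q \<longrightarrow>
        (coef (lform n c) p \<noteq> 0 \<longrightarrow> coef (lform n c) q \<noteq> 0 \<and> coef (lform n c) p = coef (lform n c) q) \<and>
        (coef (lform n c) q \<noteq> 0 \<and> coef (lform n c) p = 0 \<longrightarrow>
          (\<forall>k. (k, p) \<in> P \<and> k \<noteq> p \<longrightarrow> coef (lform n c) k = 0)))"
      by (simp only: Ball_def split_paired_All prod.case R)
    also have "\<dots> \<longleftrightarrow> upset_coefs P c"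
      unfolding upset_coefs_def
    proof (intro iff_allI imp_cong[OF refl])
      fix p q assume "ordinal_cover P p q"
      then have pq: "p \<in> {1..n}" "q \<in> {1..n}"
        using in_range unfolding ordinal_cover_def by blast+
      have k: "coef (lform n c) k = c k" if "(k, p) \<in> P" for k
        using in_range[OF that] by (simp add: coef_lform)
      show "((coef (lform n c) p \<noteq> 0 \<longrightarrow> coef (lform n c) q \<noteq> 0 \<and> coef (lform n c) p = coef (lform n c) q) \<and>
          (coef (lform n c) q \<noteq> 0 \<and> coef (lform n c) p = 0 \<longrightarrow>
            (\<forall>k. (k, p) \<in> P \<and> k \<noteq> p \<longrightarrow> coef (lform n c) k = 0))) \<longleftrightarrow>
        ((c p \<noteq> 0 \<longrightarrow> c p = c q) \<and>
          (c q \<noteq> 0 \<and> c p = 0 \<longrightarrow> (\<forall>k. (k, p) \<in> P \<and> k \<noteq> p \<longrightarrow> c k = 0)))"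
        unfolding coef_lform[OF pq(1)] coef_lform[OF pq(2)] using k by metis
    qed
    finally show ?thesis .
  qed
  note coefs = this
  have "\<forall>f\<in>#eigenvalues (promotion_mat n P). linear_form n f"
    by (auto simp: ev linear_form_def lform_def)
  moreover have "char_poly (promotion_mat n P) = (\<Prod>f\<in>#eigenvalues (promotion_mat n P). [:- f, 1:])"
    by (simp add: E ev image_mset.compositionality o_def)
  ultimately show ?thesis
    unfolding upset_property_def by (simp only: ev set_image_mset ball_simps(9) coefs simp_thms) blast
qed

section \<open>Transfer of the upset condition to \<open>P'\<close>\<close>

context ordinal_cover_poset
begin

lemma upset_coefs_P':
  assumes c: "upset_coefs P c"
  shows "upset_coefs P' c"
  using c ordinal_cover_P'(1) unfolding upset_coefs_def by blast

text \<open>The upset condition for the pair \<open>(a, b)\<close> itself; this dichotomy underlies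
  the choice between the two eigenvectors.\<close>

lemma upset_coefs_cases:
  assumes c: "upset_coefs P c"
  shows "c a = c b \<or> (\<forall>k. (k, a) \<in> P \<longrightarrow> c k = 0)"
  using c cover unfolding upset_coefs_def by metis

text \<open>If \<open>c a = c b\<close>, then \<open>p\<close> and \<open>q\<close> are both weakly
  below \<open>b\<close> or both not, so their signs change together, and zeros of \<open>c\<close>
  stay zeros. Otherwise the values at \<open>a\<close> and \<open>b\<close> are exchanged, which
  leaves those at \<open>p\<close> and \<open>q\<close> unchanged.\<close>

lemma upset_coefs_second:
  assumes c: "upset_coefs P c"
  shows "upset_coefs P' (second_coef c)"
  unfolding upset_coefs_def
proof (intro allI impI)
  fix p q assume pq': "ordinal_cover P' p q"
  note pq = ordinal_cover_P'[OF pq']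
  interpret pq: ordinal_cover_poset n P p q
    using po pq(1) by unfold_locales
  have c1: "c p \<noteq> 0 \<Longrightarrow> c p = c q"
    and c2: "\<And>k. c q \<noteq> 0 \<Longrightarrow> c p = 0 \<Longrightarrow> (k, p) \<in> P \<Longrightarrow> k \<noteq> p \<Longrightarrow> c k = 0"
    using c pq(1) unfolding upset_coefs_def by blast+
  show "(second_coef c p \<noteq> 0 \<longrightarrow> second_coef c p = second_coef c q) \<and>
    (second_coef c q \<noteq> 0 \<and> second_coef c p = 0 \<longrightarrow>
      (\<forall>k. (k, p) \<in> P' \<and> k \<noteq> p \<longrightarrow> second_coef c k = 0))"
  proof (cases "c a = c b")
    case True
    have "(p, b) \<in> P \<longleftrightarrow> (q, b) \<in> P"
    proof
      assume "(q, b) \<in> P"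
      then show "(p, b) \<in> P" using P_trans pq.ab(2) by blast
    next
      assume "(p, b) \<in> P"
      then show "(q, b) \<in> P"
        using pq.component[of p b] pq.ab_refl P_antisym[of b p] pq(2) by auto
    qed
    moreover have "second_coef c r = (if (r, b) \<in> P then - c r else c r)" if "r \<notin> {a, b}" for r
      using that True by (simp add: second_coef_def)
    note eq = this[OF pq(2)] this[OF pq(3)]
    ultimately have "second_coef c p = second_coef c q" if "c p = c q"
      using that by simp
    moreover have "second_coef c p = 0 \<longleftrightarrow> c p = 0" "second_coef c q = 0 \<longleftrightarrow> c q = 0"
      unfolding eq by simp_all
    moreover have "second_coef c k = 0" if "c k = 0" for k
      using that True by (simp add: second_coef_def)
    ultimately show ?thesis using c1 c2 by blast
  next
    case False
    then have "c a = 0" using upset_coefs_cases[OF c] ab_refl by blast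
    then have "c b \<noteq> 0" using False by metis
    have eq: "second_coef c p = c p" "second_coef c q = c q"
      using False pq(2,3) by (auto simp: second_coef_def)
    have "second_coef c k = 0" if k: "c q \<noteq> 0" "c p = 0" "(k, p) \<in> P" "k \<noteq> p" for k
    proof -
      \<comment> \<open>With \<open>b\<close> below \<open>p\<close>, the upset condition for
        \<open>(p, q)\<close> would force \<open>c b = 0\<close>; and \<open>a\<close> below
        \<open>p\<close> would put \<open>b\<close> below \<open>p\<close> too.\<close>
      have "(b, p) \<notin> P" using c2[of b] k \<open>c b \<noteq> 0\<close> pq(2) by auto
      then have "k \<noteq> a" "k \<noteq> b" using k above_a[of p] by auto
      then show ?thesis using c2[OF k] False by (simp add: second_coef_def)
    qed
    then show ?thesis unfolding eq using c1 by blast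
  qed
qed

end

theorem theorem10:
  fixes n :: nat and P Q' Q'' P2 :: "nat rel" and a b :: nat
  assumes "partial_order_on {1..n} P"
    and "has_form P Q' a b Q'' P2"
    and "simultaneously_triangularizable n P"
    and "upset_property n P"
  shows "upset_property n (P - {(a, b)}) \<and>
    eigenvalues (promotion_mat n (P - {(a, b)})) =
      eigenvalues (promotion_mat n P) + image_mset (second_eigenvalue n P a b) (eigenvalues (promotion_mat n P))"
proof -
  interpret ordinal_cover_poset n P a b
    using assms(1) has_form_ordinal_cover[OF assms(2)] by unfold_locales
  define N where "N = card (lin_exts n P)"
  obtain S S' where S: "S \<in> carrier_mat N N" "S' \<in> carrier_mat N N"
    and inv: "S * S' = 1\<^sub>m N" "S' * S = 1\<^sub>m N"
    and ut: "\<And>k. k \<in> {1..n} \<Longrightarrow> upper_triangular (S * G_mat n P k * S')"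
    using assms(3) unfolding simultaneously_triangularizable_def Let_def N_def by blast
  define c where "c = (\<lambda>s k. (S * G_mat n P k * S') $$ (s, s))"
  \<comment> \<open>One coefficient function for each diagonal index, so that multiplicities are
    kept.\<close>
  define E where "E = image_mset c (mset_set {0..<N})"
  have cp: "char_poly (promotion_mat n P) = (\<Prod>c\<in>#E. [:- lform n c, 1:])"
    using char_poly_promotion_mat[OF S[unfolded N_def] inv[unfolded N_def] ut]
    by (simp add: E_def c_def N_def prod_unfold_prod_mset image_mset.compositionality o_def)
  have upset: "upset_coefs P d" if "d \<in># E" for d
    using assms(4) upset_property_lform[OF po cp] that by simp
  have "c s a = c s b \<or> (\<forall>k. (k, a) \<in> P \<longrightarrow> c s k = 0)" if "s < N" for s
    using upset_coefs_cases[OF upset] that by (auto simp: E_def)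
  then have "char_poly (promotion_mat n P') =
      (\<Prod>s = 0..<N. [:- lform n (c s), 1:] * [:- lform n (second_coef (c s)), 1:])"
    unfolding c_def N_def
    by (intro char_poly_promotion_mat_P'[OF S[unfolded N_def] inv[unfolded N_def] ut]) auto
  also have "\<dots> = (\<Prod>c\<in>#E + image_mset second_coef E. [:- lform n c, 1:])"
    unfolding prod.distrib
    by (simp add: E_def prod_unfold_prod_mset image_mset.compositionality o_def
        del: mult_pCons_left mult_pCons_right)
  finally have cp': "char_poly (promotion_mat n P') = (\<Prod>c\<in>#E + image_mset second_coef E. [:- lform n c, 1:])" .
  have ev: "eigenvalues (promotion_mat n P) = image_mset (lform n) E"
    by (rule eigenvalues_eqI) (simp add: cp image_mset.compositionality o_def)
  have "eigenvalues (promotion_mat n P') = image_mset (lform n) (E + image_mset second_coef E)"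
    by (rule eigenvalues_eqI) (simp add: cp' image_mset.compositionality o_def)
  also have "\<dots> = image_mset (lform n) E + image_mset (lform n) (image_mset second_coef E)" by simp
  also have "image_mset (lform n) (image_mset second_coef E) =
      image_mset (second_eigenvalue n P a b) (image_mset (lform n) E)"
  proof -
    have "lform n (second_coef d) = second_eigenvalue n P a b (lform n d)" if "d \<in># E" for d
      using second_eigenvalue_lform[of d] upset_coefs_cases[OF upset[OF that]] ab_refl by metis
    then show ?thesis by (simp add: image_mset.compositionality o_def cong: image_mset_cong)
  qed
  finally have "eigenvalues (promotion_mat n P') = eigenvalues (promotion_mat n P) +
      image_mset (second_eigenvalue n P a b) (eigenvalues (promotion_mat n P))"
    by (simp add: ev)
  moreover have "upset_property n P'"
    unfolding upset_property_lform[OF partial_order_P' cp']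
    using upset upset_coefs_P' upset_coefs_second by auto
  ultimately show ?thesis by blast
qed

end
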